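(* Let $\mathcal S$ and $\mathcal P$ be graded vector bundles over graded manifolds $\mathcal M$ and $\mathcal N$, respectively. Then the following data are equivalent (the correspondence being given by $\Lambda_0=\Lambda_N$, the component of $\Lambda$ on global sections): 1. a morphism $(\varphi,\Lambda):\mathcal S\to\mathcal P$ of graded vector bundles; 2. a pair $(\varphi,\Lambda_0)$, where $\varphi:\mathcal M\to\mathcal N$ is a graded smooth map and $\Lambda_0:\mathcal P^*(N)\to\mathcal S^*(M)$ is a degree zero graded linear map satisfying $\Lambda_0(g\cdot\psi)=\varphi^*(g)\cdot\Lambda_0(\psi)$ for all $g\in C^\infty_{\mathcal N}(N)$ and $\psi\in\mathcal P^*(N)$.
   Context: Graded conventions. "Graded" means $\mathbb Z$-graded over $\mathbb R$. A graded vector space is a sequence $V=(V_i)_{i\in\mathbb Z}$ of real vector spaces; an element $v\in V$ is by definition homogeneous ($v\in V_i$, $i=|v|$) and only elements of equal degree are added. A graded linear map of degree $k$ is a family of linear maps $V_i\to W_{i+k}$. Graded algebras are associative, unital and graded commutative, $ab=(-1)^{|a||b|}ba$; their morphisms have degree $0$ and preserve units. A graded linear map $\psi$ of graded $A$-modules is $A$-linear if $\psi(a\cdot p)=(-1)^{|a||\psi|}a\cdot\psi(p)$. Graded manifolds. For non-negative integers $(m_j)_{j\in\mathbb Z}$ with finite sum, let $\tilde m=\sum_{j\neq0}m_j$ and let $\xi^1,\dots,\xi^{\tilde m}$ be variables, exactly $m_j$ of them of degree $j$ for each $j\ne 0$. The sheaf $C^\infty_{(m_j)}$ on $\mathbb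 R^{m_0}$ assigns to an open $U$ the graded algebra whose degree $k$ elements are formal power series $\sum_{\mathbf p}f_{\mathbf p}\xi^{\mathbf p}$, $f_{\mathbf p}\in C^\infty(U)$, over multi-indices $\mathbf p\in\mathbb N_0^{\tilde m}$ with $\sum_i p_i|\xi^i|=k$ and $p_i\in\{0,1\}$ if $|\xi^i|$ is odd, multiplied by the rules of graded commutativity. A graded manifold of dimension $(m_j)$ is a pair $\mathcal M=(M,C^\infty_{\mathcal M})$, with $M$ a second countable Hausdorff space and $C^\infty_{\mathcal M}$ a sheaf of graded algebras on $M$ locally isomorphic to restrictions of $C^\infty_{(m_j)}$ to open subsets of $\mathbb R^{m_0}$ (so $M$ is a smooth manifold). A graded smooth map $\varphi:\mathcal M\to\mathcal N$ is a pair $(\underline\varphi,\varphi^* )$ of a smooth map $\underline\varphi:M\to N$ and a morphism of sheaves of graded algebras $\varphi^*:C^\infty_{\mathcal N}\to\underline\varphi_*C^\infty_{\mathcal M}$ inducing local graded ring morphisms on stalks. All graded manifolds are assumed connected (i.e. $M$ is connected). Graded vector bundles. A sheaf of $C^\infty_{\mathcal M}$-modules is a sheaf $\mathcal S$ of graded vector spaces on $M$ such that each $\mathcal S(U)$ is a graded $C^\infty_{\mathcal M}(U)$-module, compatibly with restrictions; its morphisms are degree $0$ and linear. A frame over $U$ is a finite family $s_1,\dots,s_r\in\mathcal S(U)$ such that each $s\in\mathcal S(U)$ is $\sum f^i s_i$ for unique $f^i\in C^\infty_{\mathcal M}(U)$; its restrictions to smaller open sets are frames; its graded rank is $(r_j)$,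 $r_j=\#\{i:|s_i|=j\}$. A graded vector bundle over $\mathcal M$ is a sheaf of $C^\infty_{\mathcal M}$-modules admitting frames, all of the same graded rank, over the sets of some open cover of $M$. The dual sheaf $\mathcal S^*$ has $\mathcal S^*(U)$ = graded $C^\infty_{\mathcal M}(U)$-linear maps $\mathcal S(U)\to C^\infty_{\mathcal M}(U)$ of all degrees. A morphism from $\mathcal S$ (over $\mathcal M$) to $\mathcal P$ (over $\mathcal N$) is a pair $(\varphi,\Lambda)$, with $\varphi:\mathcal M\to\mathcal N$ graded smooth and $\Lambda:\mathcal P^*\to\varphi_*(\mathcal S^* )$ a morphism of sheaves of $C^\infty_{\mathcal N}$-modules, where $(\varphi_*\mathcal S^* )(U)=\mathcal S^*(\underline\varphi^{-1}(U))$ with $h\cdot\alpha:=\varphi^*(h)\,\alpha$. *)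

theory Defs
  imports "HOL-Analysis.Analysis" "HOL-Library.Function_Algebras"
begin

section \<open>Graded linear algebra\<close>

text \<open>
  A graded vector space is a family of linear subspaces, indexed by the degree, of one ambient
  type of class \<^class>\<open>real_vector\<close>. The members of the family are not assumed to be independent
  and may overlap as sets; therefore all operations and all graded maps take the degrees of their
  arguments as parameters, so that a graded map really is a family of maps. Maps are
  normalised to be \<open>0\<close> off their domain, so that equal families are equal as functions.
  Spaces of such maps are themselves subspaces, for the pointwise vector space structure.
\<close>

instantiation "fun" :: (type, real_vector) real_vector
begin

definition scaleR_fun :: "real \<Rightarrow> ('a \<Rightarrow> 'b) \<Rightarrow> 'a \<Rightarrow> 'b"
  where "scaleR_fun c f = (\<lambda>x. c *\<^sub>R f x)"

instance
  by standard (auto simp: scaleR_fun_def fun_eq_iff scaleR_add_right scaleR_add_left)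

end

definition lin_map :: "'v::real_vector set \<Rightarrow> 'w::real_vector set \<Rightarrow> ('v \<Rightarrow> 'w) \<Rightarrow> bool"
  where "lin_map V W f \<longleftrightarrow>
    (\<forall>x\<in>V. f x \<in> W) \<and>
    (\<forall>x\<in>V. \<forall>y\<in>V. f (x + y) = f x + f y) \<and>
    (\<forall>c. \<forall>x\<in>V. f (c *\<^sub>R x) = c *\<^sub>R f x)"

section \<open>Sheaves of graded vector spaces, algebras and modules\<close>

text \<open>
  \<open>sects F U k\<close> is the space of sections of degree \<open>k\<close> over \<open>U\<close>, and \<open>restr F U V k\<close> is the restriction
  from \<open>U\<close> to \<open>V\<close> in degree \<open>k\<close>. In \<open>gmul A U j k\<close> and \<open>gact S U j k\<close> the numbers \<open>j\<close>, \<open>k\<close> are the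
  degrees of the two factors. Only open sets \<open>U\<close>, \<open>V\<close> matter.
\<close>

record ('a, 'v) gsheaf =
  base :: "'a topology"
  sects :: "'a set \<Rightarrow> int \<Rightarrow> 'v set"
  restr :: "'a set \<Rightarrow> 'a set \<Rightarrow> int \<Rightarrow> 'v \<Rightarrow> 'v"

record ('a, 'f) galg_sheaf = "('a, 'f) gsheaf" +
  gone :: "'a set \<Rightarrow> 'f"
  gmul :: "'a set \<Rightarrow> int \<Rightarrow> int \<Rightarrow> 'f \<Rightarrow> 'f \<Rightarrow> 'f"

record ('a, 'f, 's) gmod_sheaf = "('a, 's) gsheaf" +
  gact :: "'a set \<Rightarrow> int \<Rightarrow> int \<Rightarrow> 'f \<Rightarrow> 's \<Rightarrow> 's"

definition graded_sheaf :: "('a, 'v::real_vector, 'z) gsheaf_scheme \<Rightarrow> bool"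
  where "graded_sheaf F \<longleftrightarrow>
    (\<forall>U k. openin (base F) U \<longrightarrow> subspace (sects F U k)) \<and>
    (\<forall>U V k. openin (base F) U \<and> openin (base F) V \<and> V \<subseteq> U \<longrightarrow>
       lin_map (sects F U k) (sects F V k) (restr F U V k)) \<and>
    (\<forall>U k. openin (base F) U \<longrightarrow> (\<forall>s\<in>sects F U k. restr F U U k s = s)) \<and>
    (\<forall>U V W k. openin (base F) U \<and> openin (base F) V \<and> openin (base F) W \<and> W \<subseteq> V \<and> V \<subseteq> U \<longrightarrow>
       (\<forall>s\<in>sects F U k. restr F V W k (restr F U V k s) = restr F U W k s)) \<and>
    (\<forall>\<U> k s. (\<forall>U\<in>\<U>. openin (base F) U \<and> s U \<in> sects F U k) \<and>
       (\<forall>U\<in>\<U>. \<forall>V\<in>\<U>. restr F U (U \<inter> V) k (s U) = restr F V (U \<inter> V) k (s V)) \<longrightarrow>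
       (\<exists>!t. t \<in> sects F (\<Union>\<U>) k \<and> (\<forall>U\<in>\<U>. restr F (\<Union>\<U>) U k t = s U)))"

definition graded_algebra_sheaf :: "('a, 'f::real_vector) galg_sheaf \<Rightarrow> bool"
  where "graded_algebra_sheaf A \<longleftrightarrow> graded_sheaf A \<and>
    (\<forall>U. openin (base A) U \<longrightarrow>
       gone A U \<in> sects A U 0 \<and>
       (\<forall>j k. \<forall>a\<in>sects A U j. lin_map (sects A U k) (sects A U (j + k)) (gmul A U j k a)) \<and>
       (\<forall>j k. \<forall>b\<in>sects A U k. lin_map (sects A U j) (sects A U (j + k)) (\<lambda>a. gmul A U j k a b)) \<and>
       (\<forall>i j k. \<forall>a\<in>sects A U i. \<forall>b\<in>sects A U j. \<forall>c\<in>sects A U k.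
          gmul A U (i + j) k (gmul A U i j a b) c = gmul A U i (j + k) a (gmul A U j k b c)) \<and>
       (\<forall>k. \<forall>a\<in>sects A U k. gmul A U 0 k (gone A U) a = a \<and> gmul A U k 0 a (gone A U) = a) \<and>
       (\<forall>j k. \<forall>a\<in>sects A U j. \<forall>b\<in>sects A U k.
          gmul A U j k a b = (-1) powi (j * k) *\<^sub>R gmul A U k j b a)) \<and>
    (\<forall>U V. openin (base A) U \<and> openin (base A) V \<and> V \<subseteq> U \<longrightarrow>
       restr A U V 0 (gone A U) = gone A V \<and>
       (\<forall>j k. \<forall>a\<in>sects A U j. \<forall>b\<in>sects A U k.
          restr A U V (j + k) (gmul A U j k a b) =
            gmul A V j k (restr A U V j a) (restr A U V k b)))"

definition graded_module_sheaf ::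
    "('a, 'f::real_vector) galg_sheaf \<Rightarrow> ('a, 'f, 's::real_vector) gmod_sheaf \<Rightarrow> bool"
  where "graded_module_sheaf A S \<longleftrightarrow> base S = base A \<and> graded_sheaf S \<and>
    (\<forall>U. openin (base A) U \<longrightarrow>
       (\<forall>j k. \<forall>a\<in>sects A U j. lin_map (sects S U k) (sects S U (j + k)) (gact S U j k a)) \<and>
       (\<forall>j k. \<forall>s\<in>sects S U k. lin_map (sects A U j) (sects S U (j + k)) (\<lambda>a. gact S U j k a s)) \<and>
       (\<forall>i j k. \<forall>a\<in>sects A U i. \<forall>b\<in>sects A U j. \<forall>s\<in>sects S U k.
          gact S U (i + j) k (gmul A U i j a b) s = gact S U i (j + k) a (gact S U j k b s)) \<and>
       (\<forall>k. \<forall>s\<in>sects S U k. gact S U 0 k (gone A U) s = s)) \<and>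
    (\<forall>U V. openin (base A) U \<and> openin (base A) V \<and> V \<subseteq> U \<longrightarrow>
       (\<forall>j k. \<forall>a\<in>sects A U j. \<forall>s\<in>sects S U k.
          restr S U V (j + k) (gact S U j k a s) =
            gact S V j k (restr A U V j a) (restr S U V k s)))"

definition sheaf_hom ::
    "('a, 'v::real_vector, 'y) gsheaf_scheme \<Rightarrow> ('a, 'w::real_vector, 'z) gsheaf_scheme \<Rightarrow>
     ('a set \<Rightarrow> int \<Rightarrow> 'v \<Rightarrow> 'w) \<Rightarrow> bool"
  where "sheaf_hom F G \<Lambda> \<longleftrightarrow> base F = base G \<and>
    (\<forall>U k. openin (base F) U \<longrightarrow> lin_map (sects F U k) (sects G U k) (\<Lambda> U k)) \<and>
    (\<forall>U V k. openin (base F) U \<and> openin (base F) V \<and> V \<subseteq> U \<longrightarrow>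
       (\<forall>s\<in>sects F U k. \<Lambda> V k (restr F U V k s) = restr G U V k (\<Lambda> U k s))) \<and>
    (\<forall>U k s. \<not> (openin (base F) U \<and> s \<in> sects F U k) \<longrightarrow> \<Lambda> U k s = 0)"

definition galg_hom ::
    "('a, 'f::real_vector) galg_sheaf \<Rightarrow> ('a, 'g::real_vector) galg_sheaf \<Rightarrow>
     ('a set \<Rightarrow> int \<Rightarrow> 'f \<Rightarrow> 'g) \<Rightarrow> bool"
  where "galg_hom A B \<Phi> \<longleftrightarrow> sheaf_hom A B \<Phi> \<and>
    (\<forall>U. openin (base A) U \<longrightarrow>
       \<Phi> U 0 (gone A U) = gone B U \<and>
       (\<forall>j k. \<forall>a\<in>sects A U j. \<forall>b\<in>sects A U k.
          \<Phi> U (j + k) (gmul A U j k a b) = gmul B U j k (\<Phi> U j a) (\<Phi> U k b)))"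

definition gmod_hom ::
    "('a, 'f::real_vector) galg_sheaf \<Rightarrow> ('a, 'f, 's::real_vector) gmod_sheaf \<Rightarrow>
     ('a, 'f, 't::real_vector) gmod_sheaf \<Rightarrow> ('a set \<Rightarrow> int \<Rightarrow> 's \<Rightarrow> 't) \<Rightarrow> bool"
  where "gmod_hom A S T \<Lambda> \<longleftrightarrow> sheaf_hom S T \<Lambda> \<and>
    (\<forall>U. openin (base A) U \<longrightarrow>
       (\<forall>j k. \<forall>a\<in>sects A U j. \<forall>s\<in>sects S U k.
          \<Lambda> U (j + k) (gact S U j k a s) = gact T U j k a (\<Lambda> U k s)))"

definition galg_iso ::
    "('a, 'f::real_vector) galg_sheaf \<Rightarrow> ('a, 'g::real_vector) galg_sheaf \<Rightarrow>
     ('a set \<Rightarrow> int \<Rightarrow> 'f \<Rightarrow> 'g) \<Rightarrow> bool"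
  where "galg_iso A B \<Phi> \<longleftrightarrow> galg_hom A B \<Phi> \<and>
    (\<forall>U k. openin (base A) U \<longrightarrow> bij_betw (\<Phi> U k) (sects A U k) (sects B U k))"

definition restrict_open :: "('a, 'v, 'z) gsheaf_scheme \<Rightarrow> 'a set \<Rightarrow> ('a, 'v, 'z) gsheaf_scheme"
  where "restrict_open F U = F\<lparr>base := subtopology (base F) U\<rparr>"

definition preim :: "'a topology \<Rightarrow> ('a \<Rightarrow> 'b) \<Rightarrow> 'b set \<Rightarrow> 'a set"
  where "preim X \<phi> V = {x \<in> topspace X. \<phi> x \<in> V}"

definition pushforward_alg ::
    "'b topology \<Rightarrow> ('a \<Rightarrow> 'b) \<Rightarrow> ('a, 'f) galg_sheaf \<Rightarrow> ('b, 'f) galg_sheaf"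
  where "pushforward_alg Y \<phi> A =
    \<lparr>base = Y,
     sects = (\<lambda>V. sects A (preim (base A) \<phi> V)),
     restr = (\<lambda>V W. restr A (preim (base A) \<phi> V) (preim (base A) \<phi> W)),
     gone = (\<lambda>V. gone A (preim (base A) \<phi> V)),
     gmul = (\<lambda>V. gmul A (preim (base A) \<phi> V))\<rparr>"

definition pushforward_mod ::
    "'b topology \<Rightarrow> ('a \<Rightarrow> 'b) \<Rightarrow> ('b set \<Rightarrow> int \<Rightarrow> 'g \<Rightarrow> 'f) \<Rightarrow>
     ('a, 'f, 's) gmod_sheaf \<Rightarrow> ('b, 'g, 's) gmod_sheaf"
  where "pushforward_mod Y \<phi> \<phi>s S =
    \<lparr>base = Y,
     sects = (\<lambda>V. sects S (preim (base S) \<phi> V)),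
     restr = (\<lambda>V W. restr S (preim (base S) \<phi> V) (preim (base S) \<phi> W)),
     gact = (\<lambda>V j k h. gact S (preim (base S) \<phi> V) j k (\<phi>s V j h))\<rparr>"

section \<open>The local model\<close>

text \<open>
  Points of \<open>\<real>\<^sup>n\<close> are sequences vanishing from position \<open>n\<close> on, as in \<^const>\<open>Euclidean_space\<close>; this
  includes \<open>n = 0\<close>.
\<close>

definition partial_deriv :: "nat \<Rightarrow> ((nat \<Rightarrow> real) \<Rightarrow> real) \<Rightarrow> (nat \<Rightarrow> real) \<Rightarrow> real"
  where "partial_deriv i f x = deriv (\<lambda>t. f (x(i := t))) (x i)"

primrec C_order :: "nat \<Rightarrow> nat \<Rightarrow> (nat \<Rightarrow> real) set \<Rightarrow> ((nat \<Rightarrow> real) \<Rightarrow> real) \<Rightarrow> bool" where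
  "C_order n 0 U f \<longleftrightarrow> continuous_map (subtopology (Euclidean_space n) U) euclideanreal f"
| "C_order n (Suc r) U f \<longleftrightarrow>
     continuous_map (subtopology (Euclidean_space n) U) euclideanreal f \<and>
     (\<forall>i<n. (\<forall>x\<in>U. (\<lambda>t. f (x(i := t))) field_differentiable at (x i)) \<and>
            C_order n r U (partial_deriv i f))"

definition C_infinity :: "nat \<Rightarrow> (nat \<Rightarrow> real) set \<Rightarrow> ((nat \<Rightarrow> real) \<Rightarrow> real) \<Rightarrow> bool"
  where "C_infinity n U f \<longleftrightarrow> (\<forall>r. C_order n r U f)"

text \<open>
  For dimensions \<open>m\<close>, the variables of nonzero degree are the pairs \<open>(j, l)\<close> with \<open>j \<noteq> 0\<close> and
  \<open>l < m j\<close>, where \<open>(j, l)\<close> has degree \<open>j\<close>; in monomials they are ordered lexicographically.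
\<close>

definition gvars :: "(int \<Rightarrow> nat) \<Rightarrow> (int \<times> nat) set"
  where "gvars m = {(j, l). j \<noteq> 0 \<and> l < m j}"

definition multi_indices :: "(int \<Rightarrow> nat) \<Rightarrow> int \<Rightarrow> (int \<times> nat \<Rightarrow> nat) set"
  where "multi_indices m k =
    {p. (\<forall>v. v \<notin> gvars m \<longrightarrow> p v = 0) \<and> (\<forall>v. odd (fst v) \<longrightarrow> p v \<le> 1) \<and>
        (\<Sum>v\<in>gvars m. int (p v) * fst v) = k}"

text \<open>
  \<open>\<xi>\<^sup>p \<xi>\<^sup>q = koszul_sign m p q \<xi>\<^bsup>p + q\<^esup>\<close>: a factor \<open>w\<close> of the second monomial has to pass every
  factor \<open>v\<close> of the first one that is larger than \<open>w\<close>.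
\<close>

definition koszul_sign :: "(int \<Rightarrow> nat) \<Rightarrow> (int \<times> nat \<Rightarrow> nat) \<Rightarrow> (int \<times> nat \<Rightarrow> nat) \<Rightarrow> real"
  where "koszul_sign m p q =
    (-1) ^ (\<Sum>(v, w) \<in> {(v, w). v \<in> gvars m \<and> w \<in> gvars m \<and> odd (fst v) \<and> odd (fst w) \<and>
                          (fst w < fst v \<or> fst w = fst v \<and> snd w < snd v)}. p v * q w)"

text \<open>
  A formal power series is the family of its coefficient functions, which are set to \<open>0\<close> off \<open>U\<close>.
  A product whose multi-index would have an entry \<open>2\<close> at an odd variable vanishes.
\<close>

definition model_sheaf ::
    "(int \<Rightarrow> nat) \<Rightarrow> (nat \<Rightarrow> real, (int \<times> nat \<Rightarrow> nat) \<Rightarrow> (nat \<Rightarrow> real) \<Rightarrow> real) galg_sheaf"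
  where "model_sheaf m =
    \<lparr>base = Euclidean_space (m 0),
     sects = (\<lambda>U k. {f. (\<forall>p. C_infinity (m 0) U (f p) \<and> (\<forall>x. x \<notin> U \<longrightarrow> f p x = 0)) \<and>
                        (\<forall>p. p \<notin> multi_indices m k \<longrightarrow> f p = (\<lambda>x. 0))}),
     restr = (\<lambda>U V k f p x. if x \<in> V then f p x else 0),
     gone = (\<lambda>U p x. if p = (\<lambda>v. 0) \<and> x \<in> U then 1 else 0),
     gmul = (\<lambda>U j k f g r x. if r \<in> multi_indices m (j + k)
       then \<Sum>(p, q) \<in> {(p, q). \<forall>v. p v + q v = r v}. koszul_sign m p q * f p x * g q x
       else 0)\<rparr>"

section \<open>Graded manifolds and graded smooth maps\<close>

text \<open>
  \<open>underlying_chart m A U h\<close>: \<open>h\<close> is the map of spaces underlying some isomorphism of the restriction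
  of \<open>A\<close> to \<open>U\<close> with the restriction of the local model to an open set. These maps form the smooth
  atlas of the underlying manifold.
\<close>

definition underlying_chart ::
    "(int \<Rightarrow> nat) \<Rightarrow> ('a, 'f::real_vector) galg_sheaf \<Rightarrow> 'a set \<Rightarrow> ('a \<Rightarrow> nat \<Rightarrow> real) \<Rightarrow> bool"
  where "underlying_chart m A U h \<longleftrightarrow> openin (base A) U \<and>
    (\<exists>W \<Phi>. openin (Euclidean_space (m 0)) W \<and>
       homeomorphic_map (subtopology (base A) U) (subtopology (Euclidean_space (m 0)) W) h \<and>
       galg_iso (restrict_open (model_sheaf m) W)
         (pushforward_alg (subtopology (Euclidean_space (m 0)) W) h (restrict_open A U)) \<Phi>)"

definition graded_manifold :: "(int \<Rightarrow> nat) \<Rightarrow> ('a, 'f::real_vector) galg_sheaf \<Rightarrow> bool"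
  where "graded_manifold m M \<longleftrightarrow>
    finite {j. m j \<noteq> 0} \<and>
    second_countable (base M) \<and> Hausdorff_space (base M) \<and> connected_space (base M) \<and>
    graded_algebra_sheaf M \<and>
    (\<forall>x\<in>topspace (base M). \<exists>U h. x \<in> U \<and> underlying_chart m M U h)"

definition germ ::
    "('a, 'v, 'z) gsheaf_scheme \<Rightarrow> 'a \<Rightarrow> int \<Rightarrow> 'a set \<Rightarrow> 'v \<Rightarrow> ('a set \<times> 'v) set"
  where "germ F x k U s =
    {(V, t). openin (base F) V \<and> x \<in> V \<and> t \<in> sects F V k \<and>
       (\<exists>W. openin (base F) W \<and> x \<in> W \<and> W \<subseteq> U \<inter> V \<and> restr F U W k s = restr F V W k t)}"

definition stalk :: "('a, 'v, 'z) gsheaf_scheme \<Rightarrow> 'a \<Rightarrow> int \<Rightarrow> ('a set \<times> 'v) set set"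
  where "stalk F x k = {germ F x k U s |U s. openin (base F) U \<and> x \<in> U \<and> s \<in> sects F U k}"

text \<open>
  Finitely many germs at \<open>x\<close> have representatives over a common neighbourhood, so the ring operations
  of the stalk are expressed on such representatives.
\<close>

definition stalk_graded_ideal ::
    "('a, 'f::real_vector) galg_sheaf \<Rightarrow> 'a \<Rightarrow> (int \<Rightarrow> ('a set \<times> 'f) set set) \<Rightarrow> bool"
  where "stalk_graded_ideal A x I \<longleftrightarrow>
    (\<forall>k. I k \<subseteq> stalk A x k) \<and>
    (\<forall>U. openin (base A) U \<and> x \<in> U \<longrightarrow>
       (\<forall>k. germ A x k U 0 \<in> I k) \<and>
       (\<forall>k. \<forall>s\<in>sects A U k. \<forall>t\<in>sects A U k.
          germ A x k U s \<in> I k \<and> germ A x k U t \<in> I k \<longrightarrow> germ A x k U (s + t) \<in> I k) \<and>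
       (\<forall>j k. \<forall>a\<in>sects A U j. \<forall>s\<in>sects A U k.
          germ A x k U s \<in> I k \<longrightarrow> germ A x (j + k) U (gmul A U j k a s) \<in> I (j + k)))"

definition stalk_proper_ideal ::
    "('a, 'f::real_vector) galg_sheaf \<Rightarrow> 'a \<Rightarrow> (int \<Rightarrow> ('a set \<times> 'f) set set) \<Rightarrow> bool"
  where "stalk_proper_ideal A x I \<longleftrightarrow> stalk_graded_ideal A x I \<and>
    germ A x 0 (topspace (base A)) (gone A (topspace (base A))) \<notin> I 0"

definition stalk_maximal_ideal ::
    "('a, 'f::real_vector) galg_sheaf \<Rightarrow> 'a \<Rightarrow> (int \<Rightarrow> ('a set \<times> 'f) set set) \<Rightarrow> bool"
  where "stalk_maximal_ideal A x I \<longleftrightarrow> stalk_proper_ideal A x I \<and>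
    (\<forall>J. stalk_proper_ideal A x J \<and> (\<forall>k. I k \<subseteq> J k) \<longrightarrow> J = I)"

text \<open>
  The stalks of a graded manifold are local graded rings, that is, they have exactly one maximal
  graded ideal; a local morphism maps the one into the other.
\<close>

definition local_on_stalks ::
    "('a, 'f::real_vector) galg_sheaf \<Rightarrow> ('b, 'g::real_vector) galg_sheaf \<Rightarrow> ('a \<Rightarrow> 'b) \<Rightarrow>
     ('b set \<Rightarrow> int \<Rightarrow> 'g \<Rightarrow> 'f) \<Rightarrow> bool"
  where "local_on_stalks M N \<phi> \<phi>s \<longleftrightarrow>
    (\<forall>x\<in>topspace (base M). \<forall>I J. stalk_maximal_ideal N (\<phi> x) I \<and> stalk_maximal_ideal M x J \<longrightarrow>
       (\<forall>V k. openin (base N) V \<and> \<phi> x \<in> V \<longrightarrow>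
          (\<forall>g\<in>sects N V k. germ N (\<phi> x) k V g \<in> I k \<longrightarrow>
             germ M x k (preim (base M) \<phi> V) (\<phi>s V k g) \<in> J k)))"

definition smooth_map ::
    "(int \<Rightarrow> nat) \<Rightarrow> ('a, 'f::real_vector) galg_sheaf \<Rightarrow>
     (int \<Rightarrow> nat) \<Rightarrow> ('b, 'g::real_vector) galg_sheaf \<Rightarrow> ('a \<Rightarrow> 'b) \<Rightarrow> bool"
  where "smooth_map m M n N \<phi> \<longleftrightarrow>
    continuous_map (base M) (base N) \<phi> \<and>
    (\<forall>U h V h'. underlying_chart m M U h \<and> underlying_chart n N V h' \<longrightarrow>
       (\<forall>i<n 0. C_infinity (m 0) (h ` {x \<in> U. \<phi> x \<in> V}) (\<lambda>y. h' (\<phi> (inv_into U h y)) i)))"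

type_synonym ('a, 'f, 'b, 'g) gmap = "('a \<Rightarrow> 'b) \<times> ('b set \<Rightarrow> int \<Rightarrow> 'g \<Rightarrow> 'f)"

definition graded_smooth_map ::
    "(int \<Rightarrow> nat) \<Rightarrow> ('a, 'f::real_vector) galg_sheaf \<Rightarrow>
     (int \<Rightarrow> nat) \<Rightarrow> ('b, 'g::real_vector) galg_sheaf \<Rightarrow> ('a, 'f, 'b, 'g) gmap \<Rightarrow> bool"
  where "graded_smooth_map m M n N \<phi> \<longleftrightarrow>
    fst \<phi> \<in> extensional (topspace (base M)) \<and>
    smooth_map m M n N (fst \<phi>) \<and>
    galg_hom N (pushforward_alg (base N) (fst \<phi>) M) (snd \<phi>) \<and>
    local_on_stalks M N (fst \<phi>) (snd \<phi>)"

section \<open>Graded vector bundles\<close>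

text \<open>
  A frame is a list of pairs of a degree and a section of that degree (the degree is not determined
  by the section, for instance if the section is \<open>0\<close>).
\<close>

definition frame ::
    "('a, 'f::real_vector) galg_sheaf \<Rightarrow> ('a, 'f, 's::real_vector) gmod_sheaf \<Rightarrow> 'a set \<Rightarrow>
     (int \<times> 's) list \<Rightarrow> bool"
  where "frame A S U F \<longleftrightarrow>
    (\<forall>(d, s)\<in>set F. s \<in> sects S U d) \<and>
    (\<forall>k. \<forall>s\<in>sects S U k. \<exists>!f. length f = length F \<and>
       (\<forall>i<length F. f ! i \<in> sects A U (k - fst (F ! i))) \<and>
       s = (\<Sum>i<length F. gact S U (k - fst (F ! i)) (fst (F ! i)) (f ! i) (snd (F ! i))))"

definition graded_vector_bundle ::
    "('a, 'f::real_vector) galg_sheaf \<Rightarrow> ('a, 'f, 's::real_vector) gmod_sheaf \<Rightarrow> bool"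
  where "graded_vector_bundle M S \<longleftrightarrow> graded_module_sheaf M S \<and>
    (\<exists>\<U> r. (\<forall>U\<in>\<U>. openin (base M) U) \<and> \<Union>\<U> = topspace (base M) \<and>
       (\<forall>U\<in>\<U>. \<exists>F. frame M S U F \<and> (\<forall>j. count_list (map fst F) j = r j)))"

definition dual_sects ::
    "('a, 'f::real_vector) galg_sheaf \<Rightarrow> ('a, 'f, 's::real_vector) gmod_sheaf \<Rightarrow>
     'a set \<Rightarrow> int \<Rightarrow> (int \<Rightarrow> 's \<Rightarrow> 'f) set"
  where "dual_sects A S U k =
    {\<alpha>. (\<forall>i. lin_map (sects S U i) (sects A U (i + k)) (\<alpha> i)) \<and>
        (\<forall>j i. \<forall>a\<in>sects A U j. \<forall>s\<in>sects S U i.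
           \<alpha> (j + i) (gact S U j i a s) = (-1) powi (j * k) *\<^sub>R gmul A U j (i + k) a (\<alpha> i s)) \<and>
        (\<forall>i s. s \<notin> sects S U i \<longrightarrow> \<alpha> i s = 0)}"

text \<open>
  The restriction of \<open>\<alpha>\<close> to \<open>V\<close> is the linear map on the sections over \<open>V\<close> that is compatible with \<open>\<alpha>\<close>;
  on a graded vector bundle it exists and is unique, by multiplication with bump functions.
\<close>

definition dual_sheaf ::
    "('a, 'f::real_vector) galg_sheaf \<Rightarrow> ('a, 'f, 's::real_vector) gmod_sheaf \<Rightarrow>
     ('a, 'f, int \<Rightarrow> 's \<Rightarrow> 'f) gmod_sheaf"
  where "dual_sheaf A S =
    \<lparr>base = base S,
     sects = dual_sects A S,
     restr = (\<lambda>U V k \<alpha>. THE \<beta>. \<beta> \<in> dual_sects A S V k \<and>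
       (\<forall>i. \<forall>s\<in>sects S U i. \<beta> i (restr S U V i s) = restr A U V (i + k) (\<alpha> i s))),
     gact = (\<lambda>U j k a \<alpha> i s. if s \<in> sects S U i then gmul A U j (i + k) a (\<alpha> i s) else 0)\<rparr>"

definition bundle_morphism ::
    "(int \<Rightarrow> nat) \<Rightarrow> ('a, 'f::real_vector) galg_sheaf \<Rightarrow> ('a, 'f, 's::real_vector) gmod_sheaf \<Rightarrow>
     (int \<Rightarrow> nat) \<Rightarrow> ('b, 'g::real_vector) galg_sheaf \<Rightarrow> ('b, 'g, 'p::real_vector) gmod_sheaf \<Rightarrow>
     ('a, 'f, 'b, 'g) gmap \<times> ('b set \<Rightarrow> int \<Rightarrow> (int \<Rightarrow> 'p \<Rightarrow> 'g) \<Rightarrow> int \<Rightarrow> 's \<Rightarrow> 'f) \<Rightarrow> bool"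
  where "bundle_morphism m M S n N P = (\<lambda>(\<phi>, \<Lambda>).
    graded_smooth_map m M n N \<phi> \<and>
    gmod_hom N (dual_sheaf N P)
      (pushforward_mod (base N) (fst \<phi>) (snd \<phi>) (dual_sheaf M S)) \<Lambda>)"

definition global_morphism_data ::
    "(int \<Rightarrow> nat) \<Rightarrow> ('a, 'f::real_vector) galg_sheaf \<Rightarrow> ('a, 'f, 's::real_vector) gmod_sheaf \<Rightarrow>
     (int \<Rightarrow> nat) \<Rightarrow> ('b, 'g::real_vector) galg_sheaf \<Rightarrow> ('b, 'g, 'p::real_vector) gmod_sheaf \<Rightarrow>
     ('a, 'f, 'b, 'g) gmap \<times> (int \<Rightarrow> (int \<Rightarrow> 'p \<Rightarrow> 'g) \<Rightarrow> int \<Rightarrow> 's \<Rightarrow> 'f) \<Rightarrow> bool"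
  where "global_morphism_data m M S n N P = (\<lambda>(\<phi>, \<Lambda>\<^sub>0).
    let X = topspace (base M); Y = topspace (base N); S' = dual_sheaf M S; P' = dual_sheaf N P in
    graded_smooth_map m M n N \<phi> \<and>
    (\<forall>k. lin_map (sects P' Y k) (sects S' X k) (\<Lambda>\<^sub>0 k)) \<and>
    (\<forall>j k. \<forall>g\<in>sects N Y j. \<forall>\<psi>\<in>sects P' Y k.
       \<Lambda>\<^sub>0 (j + k) (gact P' Y j k g \<psi>) = gact S' X j k (snd \<phi> Y j g) (\<Lambda>\<^sub>0 k \<psi>)) \<and>
    (\<forall>k \<psi>. \<psi> \<notin> sects P' Y k \<longrightarrow> \<Lambda>\<^sub>0 k \<psi> = 0))"

end

theory Submission
  imports Defs
begin

text \<open>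
  Everything rests on bump functions: a section of degree \<open>0\<close> that is \<open>1\<close> near a given point and
  vanishes outside a given neighbourhood. In a chart it is a product of smooth one-variable
  functions of the coordinates, and it is extended by zero. Multiplying with it, every section of a
  module sheaf agrees near each point with a global section, and every linear map of global sections
  is local; hence such a map extends uniquely to a morphism of sheaves. This applies first to the
  maps \<open>\<S>(U) \<rightarrow> C\<^sup>\<infinity>(U)\<close> and shows that the dual is a sheaf, and then to \<open>\<Lambda>\<^sub>0\<close>, regarded as a linear map
  over \<open>C\<^sup>\<infinity>\<close> of \<open>N\<close> from \<open>\<P>*\<close> to the push-forward of \<open>\<S>*\<close>.
\<close>

section \<open>Sections, restrictions and gluing\<close>

text \<open>The obstacle is that a section over a smaller open set need not extend to the whole
  space, so a map given on global sections has no evident value on it. A bump function yields an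
  extension that is right only near one point. This suffices because the resulting values are glued
  by the sheaf axiom: single bump functions do the work of a partition of unity. As bump functions
  have degree \<open>0\<close>, they pass through maps of any degree without a sign. The same
  problem occurs one level lower. The restriction maps of the dual are given by a definite
  description, so that even the naturality of \<open>\<Lambda>\<close> has content only once the
  extension problem is solved for maps into functions, in every degree. Both problems are therefore
  treated as one statement on homomorphisms between module sheaves over an algebra with bump
  functions. In these terms a morphism of module sheaves is the same as a global section of degree
  \<open>0\<close> of the sheaf of homomorphisms, which is the claimed correspondence for a fixed
  \<open>\<phi>\<close>.\<close>

lemma lin_map_in: "lin_map V W f \<Longrightarrow> x \<in> V \<Longrightarrow> f x \<in> W"
  and lin_map_add: "lin_map V W f \<Longrightarrow> x \<in> V \<Longrightarrow> y \<in> V \<Longrightarrow> f (x + y) = f x + f y"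
  and lin_map_scale: "lin_map V W f \<Longrightarrow> x \<in> V \<Longrightarrow> f (c *\<^sub>R x) = c *\<^sub>R f x"
  unfolding lin_map_def by blast+

lemma lin_map_zero: "subspace V \<Longrightarrow> lin_map V W f \<Longrightarrow> f 0 = 0"
  using lin_map_scale[of V W f 0 0] subspace_0 by fastforce

lemma lin_map_diff:
  assumes "subspace V" "lin_map V W f" "x \<in> V" "y \<in> V"
  shows "f (x - y) = f x - f y"
proof -
  have "f (x + (-1) *\<^sub>R y) = f x + (-1) *\<^sub>R f y"
    using assms lin_map_add[of V W f] lin_map_scale[of V W f] subspace_scale by metis
  then show ?thesis by simp
qed

lemma sects_subspace: "graded_sheaf F \<Longrightarrow> openin (base F) U \<Longrightarrow> subspace (sects F U k)"
  by (drule graded_sheaf_def[THEN iffD1, THEN conjunct1]) blast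

lemma restr_lin:
  "graded_sheaf F \<Longrightarrow> openin (base F) U \<Longrightarrow> openin (base F) V \<Longrightarrow> V \<subseteq> U \<Longrightarrow>
    lin_map (sects F U k) (sects F V k) (restr F U V k)"
  by (drule graded_sheaf_def[THEN iffD1, THEN conjunct2, THEN conjunct1]) blast

lemma restr_in:
  "graded_sheaf F \<Longrightarrow> openin (base F) U \<Longrightarrow> openin (base F) V \<Longrightarrow> V \<subseteq> U \<Longrightarrow> s \<in> sects F U k \<Longrightarrow>
    restr F U V k s \<in> sects F V k"
  using restr_lin lin_map_in by metis

lemma restr_zero:
  "graded_sheaf F \<Longrightarrow> openin (base F) U \<Longrightarrow> openin (base F) V \<Longrightarrow> V \<subseteq> U \<Longrightarrow> restr F U V k 0 = 0"
  using restr_lin lin_map_zero sects_subspace by metis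

lemma zero_in: "graded_sheaf F \<Longrightarrow> openin (base F) U \<Longrightarrow> 0 \<in> sects F U k"
  using sects_subspace subspace_0 by metis

lemma restr_id:
  "graded_sheaf F \<Longrightarrow> openin (base F) U \<Longrightarrow> s \<in> sects F U k \<Longrightarrow> restr F U U k s = s"
  by (drule graded_sheaf_def[THEN iffD1, THEN conjunct2, THEN conjunct2, THEN conjunct1]) blast

lemma restr_restr:
  assumes "graded_sheaf F" "openin (base F) U" "openin (base F) V" "openin (base F) W"
    "W \<subseteq> V" "V \<subseteq> U" "s \<in> sects F U k"
  shows "restr F V W k (restr F U V k s) = restr F U W k s"
  using assms(1)[unfolded graded_sheaf_def, THEN conjunct2, THEN conjunct2, THEN conjunct2, THEN conjunct1]
    assms(2-) by blast

lemma glue_family: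
  assumes "graded_sheaf F" "\<And>U. U \<in> \<U> \<Longrightarrow> openin (base F) U \<and> s U \<in> sects F U k"
    "\<And>U V. U \<in> \<U> \<Longrightarrow> V \<in> \<U> \<Longrightarrow> restr F U (U \<inter> V) k (s U) = restr F V (U \<inter> V) k (s V)"
  shows "\<exists>!t. t \<in> sects F (\<Union>\<U>) k \<and> (\<forall>U\<in>\<U>. restr F (\<Union>\<U>) U k t = s U)"
proof -
  note sheaf = assms(1)[unfolded graded_sheaf_def, THEN conjunct2, THEN conjunct2, THEN conjunct2,
    THEN conjunct2, rule_format, of \<U> s k]
  show ?thesis by (rule sheaf) (use assms(2,3) in blast)
qed

text \<open>
  The local data are a relation between open sets and sections: several names for the same
  section over the same set are harmless.
\<close>

lemma glue:
  assumes F: "graded_sheaf F"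
    and sec: "\<And>W t. R W t \<Longrightarrow> openin (base F) W \<and> t \<in> sects F W k"
    and compat: "\<And>W t W' t'. R W t \<Longrightarrow> R W' t' \<Longrightarrow>
      restr F W (W \<inter> W') k t = restr F W' (W \<inter> W') k t'"
    and cover: "V = \<Union>{W. \<exists>t. R W t}"
  obtains t where "t \<in> sects F V k" "\<And>W t'. R W t' \<Longrightarrow> restr F V W k t = t'"
proof -
  let ?U = "{W. \<exists>t. R W t}"
  define s where "s W = (SOME t. R W t)" for W
  have R: "R W (s W)" if "W \<in> ?U" for W
    using that someI_ex unfolding s_def by fast
  \<comment> \<open>Compatibility in the case \<open>W' = W\<close> makes \<open>R\<close>
    single-valued, so the choice made in \<open>s\<close> is immaterial.\<close>
  have s: "s W = t" if "R W t" for W t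
  proof -
    have "R W (s W)" using R that by blast
    then show ?thesis
      using compat[OF \<open>R W (s W)\<close> that] sec[OF that] sec[OF \<open>R W (s W)\<close>] restr_id[OF F] by simp
  qed
  have "\<exists>!t. t \<in> sects F (\<Union>?U) k \<and> (\<forall>W\<in>?U. restr F (\<Union>?U) W k t = s W)"
    using glue_family[OF F, of ?U s k] R sec compat by blast
  then show thesis using that cover s by blast
qed

text \<open>Uniqueness in the gluing axiom, for the cover by all open sets on which \<open>s\<close>
  and \<open>t\<close> agree: both glue the restrictions of \<open>s\<close>. Later equations
  between sections are mostly checked near a point in this way.\<close>

lemma separated:
  assumes F: "graded_sheaf F" and V: "openin (base F) V"
    and s: "s \<in> sects F V k" and t: "t \<in> sects F V k"
    and loc: "\<And>x. x \<in> V \<Longrightarrow> \<exists>W. openin (base F) W \<and> x \<in> W \<and> W \<subseteq> V \<and> restr F V W k s = restr F V W k t"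
  shows "s = t"
proof -
  let ?U = "{W. openin (base F) W \<and> W \<subseteq> V \<and> restr F V W k s = restr F V W k t}"
  have un: "\<Union>?U = V" using loc by blast
  have "\<exists>!r. r \<in> sects F (\<Union>?U) k \<and> (\<forall>W\<in>?U. restr F (\<Union>?U) W k r = restr F V W k s)"
  proof (rule glue_family[OF F])
    show "openin (base F) W \<and> restr F V W k s \<in> sects F W k" if "W \<in> ?U" for W
      using that restr_in[OF F V _ _ s] by blast
    show "restr F W (W \<inter> W') k (restr F V W k s) = restr F W' (W \<inter> W') k (restr F V W' k s)"
      if "W \<in> ?U" "W' \<in> ?U" for W W'
    proof -
      have "openin (base F) (W \<inter> W')" using that by blast
      then show ?thesis
        using that restr_restr[OF F V _ _ _ _ s, of W "W \<inter> W'"]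
          restr_restr[OF F V _ _ _ _ s, of W' "W \<inter> W'"] by simp
    qed
  qed
  then show ?thesis using s t un by (metis (mono_tags, lifting) mem_Collect_eq)
qed

section \<open>The axioms of sheaves of algebras and modules\<close>

lemmas graded_algebra_sheaf_sheaf = graded_algebra_sheaf_def[THEN iffD1, THEN conjunct1]
  and graded_algebra_sheafD =
    graded_algebra_sheaf_def[THEN iffD1, THEN conjunct2, THEN conjunct1, rule_format]

lemmas gmul_lin = graded_algebra_sheafD[THEN conjunct2, THEN conjunct1, rule_format]
  and gmul_lin_left =
    graded_algebra_sheafD[THEN conjunct2, THEN conjunct2, THEN conjunct1, rule_format]
  and gmul_assoc = graded_algebra_sheafD[THEN conjunct2, THEN conjunct2, THEN conjunct2,
    THEN conjunct1, rule_format]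
  and gmul_one = graded_algebra_sheafD[THEN conjunct2, THEN conjunct2, THEN conjunct2,
    THEN conjunct2, THEN conjunct1, rule_format, THEN conjunct1]
  and gmul_commute = graded_algebra_sheafD[THEN conjunct2, THEN conjunct2, THEN conjunct2,
    THEN conjunct2, THEN conjunct2, rule_format]
  and restr_gmul = graded_algebra_sheaf_def[THEN iffD1, THEN conjunct2, THEN conjunct2, rule_format,
    OF _ conjI[OF _ conjI], THEN conjunct2, rule_format]

lemmas module_base = graded_module_sheaf_def[THEN iffD1, THEN conjunct1]
  and module_sheaf = graded_module_sheaf_def[THEN iffD1, THEN conjunct2, THEN conjunct1]
  and graded_module_sheafD = graded_module_sheaf_def[THEN iffD1, THEN conjunct2, THEN conjunct2,
    THEN conjunct1, rule_format]
  and restr_gact = graded_module_sheaf_def[THEN iffD1, THEN conjunct2, THEN conjunct2,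
    THEN conjunct2, rule_format, OF _ conjI[OF _ conjI]]

lemmas gact_lin = graded_module_sheafD[THEN conjunct1, rule_format]
  and gact_lin_left = graded_module_sheafD[THEN conjunct2, THEN conjunct1, rule_format]
  and gact_assoc =
    graded_module_sheafD[THEN conjunct2, THEN conjunct2, THEN conjunct1, rule_format]
  and gact_one = graded_module_sheafD[THEN conjunct2, THEN conjunct2, THEN conjunct2, rule_format]

lemma gact_in:
  "graded_module_sheaf A S \<Longrightarrow> openin (base A) U \<Longrightarrow> a \<in> sects A U j \<Longrightarrow> s \<in> sects S U k \<Longrightarrow>
    gact S U j k a s \<in> sects S U (j + k)"
  by (rule lin_map_in[OF gact_lin])

text \<open>With the algebra as a module over itself, the dual becomes a sheaf of homomorphisms, and
  the extension of sections near a point also covers functions.\<close>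

definition alg_mod :: "('a, 'f) galg_sheaf \<Rightarrow> ('a, 'f, 'f) gmod_sheaf"
  where "alg_mod A = \<lparr>base = base A, sects = sects A, restr = restr A, gact = gmul A\<rparr>"

lemma alg_mod_simps [simp]:
  "base (alg_mod A) = base A" "sects (alg_mod A) = sects A" "restr (alg_mod A) = restr A"
  "gact (alg_mod A) = gmul A"
  by (simp_all add: alg_mod_def)

lemma graded_module_sheaf_alg_mod:
  assumes "graded_algebra_sheaf A"
  shows "graded_module_sheaf A (alg_mod A)"
proof -
  have "graded_sheaf (alg_mod A)"
    using graded_algebra_sheaf_sheaf[OF assms] unfolding graded_sheaf_def alg_mod_simps .
  then show ?thesis
    unfolding graded_module_sheaf_def alg_mod_simps
    by (intro conjI allI impI ballI refl gmul_lin[OF assms] gmul_lin_left[OF assms]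
        gmul_assoc[OF assms] gmul_one[OF assms] restr_gmul[OF assms]) auto
qed

section \<open>Bump functions and the sheaf of homomorphisms\<close>

text \<open>Here \<open>V'\<close> is the complement of the support of \<open>\<rho>\<close>.\<close>

definition has_bumps :: "('a, 'f::real_vector) galg_sheaf \<Rightarrow> bool"
  where "has_bumps A \<longleftrightarrow> (\<forall>V x. openin (base A) V \<and> x \<in> V \<longrightarrow>
    (\<exists>\<rho> W V'. \<rho> \<in> sects A (topspace (base A)) 0 \<and>
       openin (base A) W \<and> x \<in> W \<and> W \<subseteq> V \<and> restr A (topspace (base A)) W 0 \<rho> = gone A W \<and>
       openin (base A) V' \<and> V \<union> V' = topspace (base A) \<and> restr A (topspace (base A)) V' 0 \<rho> = 0))"

text \<open>The global bump function is restricted to \<open>U\<close>, and the complement of its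
  support is cut down to \<open>V' \<inter> U\<close>.\<close>

lemma bump:
  assumes A: "graded_algebra_sheaf A" and "has_bumps A"
    and U: "openin (base A) U" and V: "openin (base A) V" "V \<subseteq> U" "x \<in> V"
  obtains \<rho> W V' where "\<rho> \<in> sects A U 0" "openin (base A) W" "x \<in> W" "W \<subseteq> V"
    "restr A U W 0 \<rho> = gone A W" "openin (base A) V'" "V \<union> V' = U" "restr A U V' 0 \<rho> = 0"
proof -
  let ?X = "topspace (base A)"
  note sh = graded_algebra_sheaf_sheaf[OF A]
  obtain \<rho> W V' where *: "\<rho> \<in> sects A ?X 0" "openin (base A) W" "x \<in> W" "W \<subseteq> V"
    "restr A ?X W 0 \<rho> = gone A W" "openin (base A) V'" "V \<union> V' = ?X" "restr A ?X V' 0 \<rho> = 0"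
    using assms unfolding has_bumps_def by metis
  have X: "openin (base A) ?X" by simp
  have UX: "U \<subseteq> ?X" using U openin_subset by blast
  have V'U: "openin (base A) (V' \<inter> U)" using * U by blast
  have V'X: "V' \<subseteq> ?X" using * by blast
  show thesis
  proof
    show "restr A ?X U 0 \<rho> \<in> sects A U 0" using restr_in[OF sh X U UX] * by blast
    show "restr A U W 0 (restr A ?X U 0 \<rho>) = gone A W"
      using restr_restr[OF sh X U, of W] * UX V by auto
    have "restr A U (V' \<inter> U) 0 (restr A ?X U 0 \<rho>) = restr A V' (V' \<inter> U) 0 (restr A ?X V' 0 \<rho>)"
      using restr_restr[OF sh X U V'U _ UX *(1)] restr_restr[OF sh X *(6) V'U _ V'X *(1)] by simp
    then show "restr A U (V' \<inter> U) 0 (restr A ?X U 0 \<rho>) = 0"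
      using restr_zero[OF sh _ V'U] * by simp
  qed (use * V V'U UX in auto)
qed

text \<open>Modelled on \<open>dual_sects\<close>, with an arbitrary target module: the target
  \<open>alg_mod A\<close> gives back the dual, and degree \<open>d = 0\<close> gives linear maps
  without signs, the components of morphisms of module sheaves.\<close>

definition hom_sects ::
    "('a, 'f::real_vector) galg_sheaf \<Rightarrow> ('a, 'f, 's::real_vector) gmod_sheaf \<Rightarrow>
     ('a, 'f, 't::real_vector) gmod_sheaf \<Rightarrow> 'a set \<Rightarrow> int \<Rightarrow> (int \<Rightarrow> 's \<Rightarrow> 't) set"
  where "hom_sects A F G U d =
    {\<alpha>. (\<forall>i. lin_map (sects F U i) (sects G U (i + d)) (\<alpha> i)) \<and>
        (\<forall>j i. \<forall>a\<in>sects A U j. \<forall>s\<in>sects F U i.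
           \<alpha> (j + i) (gact F U j i a s) = (-1) powi (j * d) *\<^sub>R gact G U j (i + d) a (\<alpha> i s)) \<and>
        (\<forall>i s. s \<notin> sects F U i \<longrightarrow> \<alpha> i s = 0)}"

definition hom_sheaf ::
    "('a, 'f::real_vector) galg_sheaf \<Rightarrow> ('a, 'f, 's::real_vector) gmod_sheaf \<Rightarrow>
     ('a, 'f, 't::real_vector) gmod_sheaf \<Rightarrow> ('a, 'f, int \<Rightarrow> 's \<Rightarrow> 't) gmod_sheaf"
  where "hom_sheaf A F G =
    \<lparr>base = base F,
     sects = hom_sects A F G,
     restr = (\<lambda>U V d \<alpha>. THE \<beta>. \<beta> \<in> hom_sects A F G V d \<and>
       (\<forall>i. \<forall>s\<in>sects F U i. \<beta> i (restr F U V i s) = restr G U V (i + d) (\<alpha> i s))),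
     gact = (\<lambda>U j d a \<alpha> i s. if s \<in> sects F U i then gact G U j (i + d) a (\<alpha> i s) else 0)\<rparr>"

lemma dual_sheaf_eq: "dual_sheaf A S = hom_sheaf A S (alg_mod A)"
proof -
  have "dual_sects A S = hom_sects A S (alg_mod A)"
    by (simp add: fun_eq_iff dual_sects_def hom_sects_def)
  then show ?thesis by (simp add: dual_sheaf_def hom_sheaf_def cong: if_cong)
qed

lemma hom_sheaf_simps [simp]:
  "base (hom_sheaf A F G) = base F" "sects (hom_sheaf A F G) = hom_sects A F G"
  "gact (hom_sheaf A F G) U j d a \<alpha> i s =
    (if s \<in> sects F U i then gact G U j (i + d) a (\<alpha> i s) else 0)"
  by (simp_all add: hom_sheaf_def)

lemma
  assumes "\<alpha> \<in> hom_sects A F G U d"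
  shows hom_lin: "lin_map (sects F U i) (sects G U (i + d)) (\<alpha> i)"
    and hom_gact: "a \<in> sects A U j \<Longrightarrow> s \<in> sects F U i \<Longrightarrow>
      \<alpha> (j + i) (gact F U j i a s) = (-1) powi (j * d) *\<^sub>R gact G U j (i + d) a (\<alpha> i s)"
    and hom_off: "s \<notin> sects F U i \<Longrightarrow> \<alpha> i s = 0"
  using assms unfolding hom_sects_def by auto

lemma hom_in: "\<alpha> \<in> hom_sects A F G U d \<Longrightarrow> s \<in> sects F U i \<Longrightarrow> \<alpha> i s \<in> sects G U (i + d)"
  by (rule lin_map_in[OF hom_lin])

lemma hom_sects_eqI:
  assumes "\<alpha> \<in> hom_sects A F G U d" "\<beta> \<in> hom_sects A F G U d"
    "\<And>i s. s \<in> sects F U i \<Longrightarrow> \<alpha> i s = \<beta> i s"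
  shows "\<alpha> = \<beta>"
proof (intro ext)
  fix i s show "\<alpha> i s = \<beta> i s"
    using assms(3) hom_off[OF assms(1)] hom_off[OF assms(2)] by (cases "s \<in> sects F U i") auto
qed

text \<open>The base space enters only through \<open>has_bumps\<close>. Thus one locale serves for
  a bundle and the functions on its base, for the dual of \<open>P\<close> and a push-forward over
  \<open>N\<close>, and for functions in the role of \<open>F\<close>.\<close>

locale module_pair =
  fixes A :: "('a, 'f::real_vector) galg_sheaf"
    and F :: "('a, 'f, 's::real_vector) gmod_sheaf" and G :: "('a, 'f, 't::real_vector) gmod_sheaf"
  assumes alg: "graded_algebra_sheaf A" and bumps: "has_bumps A"
    and modF: "graded_module_sheaf A F" and modG: "graded_module_sheaf A G"
begin

abbreviation "opn \<equiv> openin (base A)"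

lemmas baseF = module_base[OF modF] and baseG = module_base[OF modG]

lemmas shA = graded_algebra_sheaf_sheaf[OF alg]
  and shF = module_sheaf[OF modF, unfolded baseF] and shG = module_sheaf[OF modG, unfolded baseG]

lemmas restr_inF = restr_in[OF shF, unfolded baseF]
  and restr_inG = restr_in[OF shG, unfolded baseG]
  and restr_restrF = restr_restr[OF shF, unfolded baseF]
  and restr_restrG = restr_restr[OF shG, unfolded baseG]
  and restr_linF = restr_lin[OF shF, unfolded baseF]
  and restr_linG = restr_lin[OF shG, unfolded baseG]
  and restr_idF = restr_id[OF shF, unfolded baseF]
  and restr_idG = restr_id[OF shG, unfolded baseG]
  and restr_zeroF = restr_zero[OF shF, unfolded baseF]
  and restr_zeroG = restr_zero[OF shG, unfolded baseG]
  and subspaceF = sects_subspace[OF shF, unfolded baseF]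
  and subspaceG = sects_subspace[OF shG, unfolded baseG]
  and separatedF = separated[OF shF, unfolded baseF]
  and separatedG = separated[OF shG, unfolded baseG]

section \<open>Extension of sections and locality of homomorphisms\<close>

lemma gact_zero_left:
  "opn U \<Longrightarrow> s \<in> sects F U i \<Longrightarrow> gact F U j i 0 s = 0"
  using lin_map_zero[OF sects_subspace[OF shA] gact_lin_left[OF modF]] by blast

text \<open>Multiply \<open>s\<close> by a bump function supported in \<open>V\<close> and glue the
  product with \<open>0\<close> on \<open>V'\<close>; the two agree on \<open>V \<inter> V'\<close>,
  where the bump function vanishes. On \<open>W\<close> it is the unit, so \<open>s\<close> is
  unchanged there.\<close>

lemma extend_near:
  assumes U: "opn U" and V: "opn V" "V \<subseteq> U" and x: "x \<in> V" and s: "s \<in> sects F V i"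
  obtains W s' where "opn W" "x \<in> W" "W \<subseteq> V" "s' \<in> sects F U i" "restr F U W i s' = restr F V W i s"
proof -
  obtain \<rho> W V' where \<rho>: "\<rho> \<in> sects A U 0" "opn W" "x \<in> W" "W \<subseteq> V"
    "restr A U W 0 \<rho> = gone A W" "opn V'" "V \<union> V' = U" "restr A U V' 0 \<rho> = 0"
    using bump[OF alg bumps U V x] by metis
  define r where "r = restr A U V 0 \<rho>"
  have r: "r \<in> sects A V 0" using restr_in[OF shA U V] \<rho> r_def by blast
  define t where "t = gact F V 0 i r s"
  have t: "t \<in> sects F V i" using gact_in[OF modF V(1) r s] t_def by simp
  have V': "V' \<subseteq> U" using \<rho> by blast
  have VV': "opn (V \<inter> V')" using \<rho> V by blast
  have "restr A V (V \<inter> V') 0 r = restr A V' (V \<inter> V') 0 (restr A U V' 0 \<rho>)"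
    unfolding r_def
    using restr_restr[OF shA U V(1) VV' _ V(2) \<rho>(1)] restr_restr[OF shA U \<rho>(6) VV' _ V' \<rho>(1)] by simp
  also have "\<dots> = 0" using restr_zero[OF shA \<rho>(6) VV'] \<rho> by simp
  finally have r0: "restr A V (V \<inter> V') 0 r = 0" .
  have t0: "restr F V (V \<inter> V') i t = 0"
    using restr_gact[OF modF V(1) VV' _ r s] r0 gact_zero_left[OF VV' restr_inF[OF V(1) VV' _ s]]
    unfolding t_def by simp
  \<comment> \<open>A relation rather than a function of the open set, because \<open>V = V'\<close>
    is not excluded.\<close>
  let ?R = "\<lambda>W u. W = V \<and> u = t \<or> W = V' \<and> u = 0"
  have "\<exists>s'. s' \<in> sects F U i \<and> (\<forall>W u. ?R W u \<longrightarrow> restr F U W i s' = u)"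
  proof (rule glue[OF shF, where R = ?R and V = U and k = i])
    show "openin (base F) W \<and> u \<in> sects F W i" if "?R W u" for W u
      using that V t \<rho> zero_in[OF shF] baseF by auto
    show "restr F W (W \<inter> W') i u = restr F W' (W \<inter> W') i u'" if "?R W u" "?R W' u'" for W u W' u'
      using that t0 restr_zeroF[OF \<rho>(6) VV'] by (auto simp: Int_commute)
    show "U = \<Union>{W. \<exists>u. ?R W u}" using \<rho>(7) by auto
  qed blast
  then obtain s' where s': "s' \<in> sects F U i" "restr F U V i s' = t" by blast
  have "restr F U W i s' = restr F V W i t"
    using restr_restrF[OF U V(1) \<rho>(2) _ _ s'(1)] s' \<rho> V by simp
  also have "\<dots> = gact F W 0 i (restr A V W 0 r) (restr F V W i s)"
    using restr_gact[OF modF V(1) \<rho>(2) _ r s] \<rho> unfolding t_def by simp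
  also have "restr A V W 0 r = gone A W"
    unfolding r_def using restr_restr[OF shA U V(1) \<rho>(2)] \<rho> V by simp
  finally have "restr F U W i s' = restr F V W i s"
    using gact_one[OF modF \<rho>(2) restr_inF[OF V(1) \<rho>(2) _ s]] \<rho> by simp
  then show thesis using that[OF \<rho>(2,3,4) s'(1)] by blast
qed

text \<open>For a bump function \<open>\<rho>\<close> supported in \<open>W\<close>, the product of
  \<open>\<rho>\<close> and \<open>s\<close> is zero on \<open>W\<close> because of \<open>s\<close>
  and on \<open>V'\<close> because of \<open>\<rho>\<close>, hence everywhere. By linearity
  \<open>\<rho>\<close> then kills \<open>\<alpha> i s\<close>, which must vanish where
  \<open>\<rho>\<close> is the unit.\<close>

lemma hom_local_zero:
  assumes \<alpha>: "\<alpha> \<in> hom_sects A F G U d" and U: "opn U" and W: "opn W" "W \<subseteq> U"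
    and s: "s \<in> sects F U i" and s0: "restr F U W i s = 0"
  shows "restr G U W (i + d) (\<alpha> i s) = 0"
proof (rule separatedG[OF W(1)])
  note \<alpha>s = hom_in[OF \<alpha> s]
  show "restr G U W (i + d) (\<alpha> i s) \<in> sects G W (i + d)"
    by (rule restr_inG[OF U W \<alpha>s])
  show "0 \<in> sects G W (i + d)" using zero_in[OF shG] baseG W by simp
  fix x assume x: "x \<in> W"
  obtain \<rho> T V' where \<rho>: "\<rho> \<in> sects A U 0" "opn T" "x \<in> T" "T \<subseteq> W"
    "restr A U T 0 \<rho> = gone A T" "opn V'" "W \<union> V' = U" "restr A U V' 0 \<rho> = 0"
    using bump[OF alg bumps U W x] by metis
  have V': "V' \<subseteq> U" using \<rho> by blast
  have \<rho>s: "gact F U 0 i \<rho> s \<in> sects F U i" using gact_in[OF modF U \<rho>(1) s] by simp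
  have "gact F U 0 i \<rho> s = 0"
  proof (rule separatedF[OF U \<rho>s])
    show "0 \<in> sects F U i" using zero_in[OF shF] baseF U by simp
    fix y assume y: "y \<in> U"
    have "restr F U W i (gact F U 0 i \<rho> s) = 0"
      using restr_gact[OF modF U W \<rho>(1) s] s0 restr_in[OF shA U W \<rho>(1)]
        lin_map_zero[OF subspaceF[OF W(1)] gact_lin[OF modF W(1)]] by simp
    moreover have "restr F U V' i (gact F U 0 i \<rho> s) = 0"
      using restr_gact[OF modF U \<rho>(6) V' \<rho>(1) s] \<rho>(8)
        gact_zero_left[OF \<rho>(6) restr_inF[OF U \<rho>(6) V' s]] by simp
    ultimately show "\<exists>T. opn T \<and> y \<in> T \<and> T \<subseteq> U \<and>
        restr F U T i (gact F U 0 i \<rho> s) = restr F U T i 0"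
      using y \<rho> W V' restr_zeroF[OF U] by (metis UnE)
  qed
  then have "gact G U 0 (i + d) \<rho> (\<alpha> i s) = \<alpha> i 0"
    using hom_gact[OF \<alpha> \<rho>(1) s] by simp
  also have "\<alpha> i 0 = 0" by (rule lin_map_zero[OF subspaceF[OF U] hom_lin[OF \<alpha>]])
  finally have 0: "gact G U 0 (i + d) \<rho> (\<alpha> i s) = 0" .
  have TU: "T \<subseteq> U" using \<rho> W by blast
  have "restr G U T (i + d) (\<alpha> i s) = gact G T 0 (i + d) (restr A U T 0 \<rho>) (restr G U T (i + d) (\<alpha> i s))"
    using gact_one[OF modG \<rho>(2) restr_inG[OF U \<rho>(2) TU \<alpha>s]] \<rho> by simp
  also have "\<dots> = restr G U T (i + d) (gact G U 0 (i + d) \<rho> (\<alpha> i s))"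
    using restr_gact[OF modG U \<rho>(2) TU \<rho>(1) \<alpha>s] by simp
  also have "\<dots> = 0" using 0 restr_zeroG[OF U \<rho>(2) TU] by simp
  finally have "restr G U T (i + d) (\<alpha> i s) = 0" .
  then show "\<exists>T. opn T \<and> x \<in> T \<and> T \<subseteq> W \<and>
      restr G W T (i + d) (restr G U W (i + d) (\<alpha> i s)) = restr G W T (i + d) 0"
    using \<rho> restr_restrG[OF U W(1) \<rho>(2) _ W(2) \<alpha>s] restr_zeroG[OF W(1) \<rho>(2)] by metis
qed

lemma hom_local:
  assumes \<alpha>: "\<alpha> \<in> hom_sects A F G U d" and U: "opn U" and W: "opn W" "W \<subseteq> U"
    and s: "s \<in> sects F U i" "t \<in> sects F U i" and eq: "restr F U W i s = restr F U W i t"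
  shows "restr G U W (i + d) (\<alpha> i s) = restr G U W (i + d) (\<alpha> i t)"
proof -
  have "restr F U W i (s - t) = 0"
    using lin_map_diff[OF subspaceF[OF U] restr_linF[OF U W] s] eq by simp
  then have "restr G U W (i + d) (\<alpha> i (s - t)) = 0"
    using hom_local_zero[OF \<alpha> U W] subspace_diff[OF subspaceF[OF U] s] by blast
  then show ?thesis
    using lin_map_diff[OF subspaceF[OF U] hom_lin[OF \<alpha>] s]
      lin_map_diff[OF subspaceG[OF U] restr_linG[OF U W] hom_in[OF \<alpha> s(1)] hom_in[OF \<alpha> s(2)]] by simp
qed

text \<open>The condition inside the definite description for \<open>restr\<close> in
  \<open>hom_sheaf\<close>. For \<open>d = 0\<close> it is also the naturality square of a morphism
  of sheaves, and this double role lets restrictions of one global map form a morphism.\<close>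

definition compat :: "'a set \<Rightarrow> 'a set \<Rightarrow> int \<Rightarrow> (int \<Rightarrow> 's \<Rightarrow> 't) \<Rightarrow> (int \<Rightarrow> 's \<Rightarrow> 't) \<Rightarrow> bool"
  where "compat U V d \<alpha> \<beta> \<longleftrightarrow>
    (\<forall>i. \<forall>s\<in>sects F U i. \<beta> i (restr F U V i s) = restr G U V (i + d) (\<alpha> i s))"

lemma compatD:
  "compat U V d \<alpha> \<beta> \<Longrightarrow> s \<in> sects F U i \<Longrightarrow> \<beta> i (restr F U V i s) = restr G U V (i + d) (\<alpha> i s)"
  unfolding compat_def by blast

text \<open>Compatibility fixes the values on sections restricted from \<open>U\<close>. Near each
  point every section over \<open>V\<close> agrees with such a one, and homomorphisms are
  local.\<close>

lemma compat_unique: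
  assumes U: "opn U" and V: "opn V" "V \<subseteq> U"
    and \<beta>: "\<beta> \<in> hom_sects A F G V d" "compat U V d \<alpha> \<beta>"
    and \<gamma>: "\<gamma> \<in> hom_sects A F G V d" "compat U V d \<alpha> \<gamma>"
  shows "\<beta> = \<gamma>"
proof (rule hom_sects_eqI[OF \<beta>(1) \<gamma>(1)])
  fix i s assume s: "s \<in> sects F V i"
  show "\<beta> i s = \<gamma> i s"
  proof (rule separatedG[OF V(1) hom_in[OF \<beta>(1) s] hom_in[OF \<gamma>(1) s]])
    fix x assume x: "x \<in> V"
    obtain W s' where W: "opn W" "x \<in> W" "W \<subseteq> V" and s': "s' \<in> sects F U i"
      and eq: "restr F U W i s' = restr F V W i s"
      using extend_near[OF U V x s] by metis
    define t where "t = restr F U V i s'"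
    have t: "t \<in> sects F V i" using restr_inF[OF U V s'] t_def by simp
    have "restr F V W i s = restr F V W i t"
      unfolding t_def using restr_restrF[OF U V(1) W(1) W(3) V(2) s'] eq by simp
    then have "restr G V W (i + d) (\<beta> i s) = restr G V W (i + d) (\<beta> i t)"
      "restr G V W (i + d) (\<gamma> i s) = restr G V W (i + d) (\<gamma> i t)"
      using hom_local[OF \<beta>(1) V(1) W(1,3) s t] hom_local[OF \<gamma>(1) V(1) W(1,3) s t] by auto
    moreover have "\<beta> i t = \<gamma> i t"
      unfolding t_def using compatD[OF \<beta>(2) s'] compatD[OF \<gamma>(2) s'] by simp
    ultimately show "\<exists>W. opn W \<and> x \<in> W \<and> W \<subseteq> V \<and>
      restr G V W (i + d) (\<beta> i s) = restr G V W (i + d) (\<gamma> i s)"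
      using W by metis
  qed
qed

text \<open>
  The restriction of \<open>\<alpha>\<close> is described by its values near a point: there a section over \<open>V\<close> agrees
  with a section over \<open>U\<close>, to which \<open>\<alpha>\<close> can be applied.
\<close>

lemma compat_exists:
  assumes \<alpha>: "\<alpha> \<in> hom_sects A F G U d" and U: "opn U" and V: "opn V" "V \<subseteq> U"
  obtains \<beta> where "\<beta> \<in> hom_sects A F G V d" "compat U V d \<alpha> \<beta>"
proof -
  \<comment> \<open>The local candidates for the value at \<open>s\<close>: on \<open>W\<close> the
    section \<open>s\<close> extends to some \<open>s'\<close> over \<open>U\<close>, and
    \<open>t\<close> is what \<open>\<alpha>\<close> makes of it. That \<open>t\<close> does not
    depend on \<open>s'\<close> follows from the compatibility shown next.\<close>
  define R where "R i s W t \<longleftrightarrow> opn W \<and> W \<subseteq> V \<and>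
      (\<exists>s'\<in>sects F U i. restr F U W i s' = restr F V W i s \<and> t = restr G U W (i + d) (\<alpha> i s'))"
    for i s W t
  have ex: "\<exists>t. t \<in> sects G V (i + d) \<and> (\<forall>W u. R i s W u \<longrightarrow> restr G V W (i + d) t = u)"
    if s: "s \<in> sects F V i" for i s
  proof (rule glue[OF shG, where R = "R i s" and V = V and k = "i + d"])
    show "openin (base G) W \<and> t \<in> sects G W (i + d)" if "R i s W t" for W t
      using that V restr_inG[OF U _ _ hom_in[OF \<alpha>]] baseG unfolding R_def by auto
    show "restr G W (W \<inter> W') (i + d) t = restr G W' (W \<inter> W') (i + d) t'"
      if R: "R i s W t" "R i s W' t'" for W t W' t'
    proof -
      obtain s1 where 1: "opn W" "W \<subseteq> V" "s1 \<in> sects F U i" "restr F U W i s1 = restr F V W i s"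
        "t = restr G U W (i + d) (\<alpha> i s1)" using R(1) unfolding R_def by blast
      obtain s2 where 2: "opn W'" "W' \<subseteq> V" "s2 \<in> sects F U i" "restr F U W' i s2 = restr F V W' i s"
        "t' = restr G U W' (i + d) (\<alpha> i s2)" using R(2) unfolding R_def by blast
      let ?I = "W \<inter> W'"
      have I: "opn ?I" using 1 2 by blast
      have "restr F U ?I i s1 = restr F W ?I i (restr F U W i s1)"
        using restr_restrF[OF U 1(1) I _ _ 1(3)] 1 V by auto
      also have "\<dots> = restr F V ?I i s"
        unfolding 1(4) using restr_restrF[OF V(1) 1(1) I _ _ s] 1 by auto
      also have "\<dots> = restr F W' ?I i (restr F U W' i s2)"
        unfolding 2(4) using restr_restrF[OF V(1) 2(1) I _ _ s] 2 by auto
      also have "\<dots> = restr F U ?I i s2"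
        using restr_restrF[OF U 2(1) I _ _ 2(3)] 2 V by auto
      \<comment> \<open>The two extensions are equal only on \<open>?I\<close>, so locality of
        \<open>\<alpha>\<close> is what makes the candidates agree.\<close>
      finally have "restr G U ?I (i + d) (\<alpha> i s1) = restr G U ?I (i + d) (\<alpha> i s2)"
        using hom_local[OF \<alpha> U I _ 1(3) 2(3)] 1 V by blast
      then show ?thesis
        unfolding 1(5) 2(5)
        using restr_restrG[OF U 1(1) I _ _ hom_in[OF \<alpha> 1(3)]]
          restr_restrG[OF U 2(1) I _ _ hom_in[OF \<alpha> 2(3)]] 1 2 V by auto
    qed
    show "V = \<Union>{W. \<exists>t. R i s W t}"
    proof
      show "V \<subseteq> \<Union>{W. \<exists>t. R i s W t}"
      proof
        fix x assume x: "x \<in> V"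
        show "x \<in> \<Union>{W. \<exists>t. R i s W t}"
          by (rule extend_near[OF U V x s]) (auto simp: R_def)
      qed
    qed (auto simp: R_def)
  qed blast
  define \<beta> where "\<beta> i s = (if s \<in> sects F V i
    then SOME t. t \<in> sects G V (i + d) \<and> (\<forall>W u. R i s W u \<longrightarrow> restr G V W (i + d) t = u) else 0)" for i s
  have \<beta>: "\<beta> i s \<in> sects G V (i + d) \<and> (\<forall>W u. R i s W u \<longrightarrow> restr G V W (i + d) (\<beta> i s) = u)"
    if "s \<in> sects F V i" for i s
    unfolding \<beta>_def using someI_ex[OF ex[OF that]] that by simp
  have \<beta>W: "restr G V W (i + d) (\<beta> i s) = restr G U W (i + d) (\<alpha> i s')"
    if "s \<in> sects F V i" "opn W" "W \<subseteq> V" "s' \<in> sects F U i" "restr F U W i s' = restr F V W i s"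
    for i s W s'
    using \<beta>[OF that(1)] that unfolding R_def by blast
  have near: "\<exists>W s'. opn W \<and> x \<in> W \<and> W \<subseteq> V \<and> s' \<in> sects F U i \<and>
      restr F U W i s' = restr F V W i s" if "x \<in> V" "s \<in> sects F V i" for x i s
    using extend_near[OF U V that] by metis
  \<comment> \<open>Each law for \<open>\<beta>\<close> is checked near a point, on an open set
    where all arguments come from sections over \<open>U\<close>; there it is the corresponding law
    for \<open>\<alpha>\<close>.\<close>
  have lin: "lin_map (sects F V i) (sects G V (i + d)) (\<beta> i)" for i
    unfolding lin_map_def
  proof (intro conjI ballI allI)
    fix s assume s: "s \<in> sects F V i"
    show "\<beta> i s \<in> sects G V (i + d)" using \<beta>[OF s] by blast
    fix t assume t: "t \<in> sects F V i"
    have st: "s + t \<in> sects F V i" using subspace_add[OF subspaceF[OF V(1)] s t] .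
    show "\<beta> i (s + t) = \<beta> i s + \<beta> i t"
    proof (rule separatedG[OF V(1)])
      show "\<beta> i (s + t) \<in> sects G V (i + d)" using \<beta>[OF st] by blast
      show "\<beta> i s + \<beta> i t \<in> sects G V (i + d)"
        using subspace_add[OF subspaceG[OF V(1)]] \<beta>[OF s] \<beta>[OF t] by blast
      fix x assume x: "x \<in> V"
      obtain W1 s' where 1: "opn W1" "x \<in> W1" "W1 \<subseteq> V" "s' \<in> sects F U i"
        "restr F U W1 i s' = restr F V W1 i s" using near[OF x s] by blast
      obtain W2 t' where 2: "opn W2" "x \<in> W2" "W2 \<subseteq> V" "t' \<in> sects F U i"
        "restr F U W2 i t' = restr F V W2 i t" using near[OF x t] by blast
      let ?W = "W1 \<inter> W2"
      have W: "opn ?W" "?W \<subseteq> V" "?W \<subseteq> U" using 1 2 V by auto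
      have s': "restr F U ?W i s' = restr F V ?W i s"
        using restr_restrF[OF U 1(1) W(1) _ _ 1(4)] restr_restrF[OF V(1) 1(1) W(1) _ _ s] 1 V by auto
      have t': "restr F U ?W i t' = restr F V ?W i t"
        using restr_restrF[OF U 2(1) W(1) _ _ 2(4)] restr_restrF[OF V(1) 2(1) W(1) _ _ t] 2 V by auto
      have "restr F U ?W i (s' + t') = restr F V ?W i (s + t)"
        using lin_map_add[OF restr_linF[OF U W(1,3)] 1(4) 2(4)]
          lin_map_add[OF restr_linF[OF V(1) W(1,2)] s t] s' t' by simp
      then have "restr G V ?W (i + d) (\<beta> i (s + t)) = restr G U ?W (i + d) (\<alpha> i (s' + t'))"
        using \<beta>W[OF st W(1,2)] subspace_add[OF subspaceF[OF U] 1(4) 2(4)] by blast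
      also have "\<dots> = restr G U ?W (i + d) (\<alpha> i s') + restr G U ?W (i + d) (\<alpha> i t')"
        using lin_map_add[OF hom_lin[OF \<alpha>] 1(4) 2(4)]
          lin_map_add[OF restr_linG[OF U W(1,3)] hom_in[OF \<alpha> 1(4)] hom_in[OF \<alpha> 2(4)]] by simp
      also have "\<dots> = restr G V ?W (i + d) (\<beta> i s) + restr G V ?W (i + d) (\<beta> i t)"
        using \<beta>W[OF s W(1,2) 1(4) s'] \<beta>W[OF t W(1,2) 2(4) t'] by simp
      also have "\<dots> = restr G V ?W (i + d) (\<beta> i s + \<beta> i t)"
        using lin_map_add[OF restr_linG[OF V(1) W(1,2)]] \<beta>[OF s] \<beta>[OF t] by simp
      finally show "\<exists>W. opn W \<and> x \<in> W \<and> W \<subseteq> V \<and>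
        restr G V W (i + d) (\<beta> i (s + t)) = restr G V W (i + d) (\<beta> i s + \<beta> i t)"
        using W 1 2 by blast
    qed
  next
    fix c :: real and s assume s: "s \<in> sects F V i"
    have cs: "c *\<^sub>R s \<in> sects F V i" using subspace_scale[OF subspaceF[OF V(1)] s] .
    show "\<beta> i (c *\<^sub>R s) = c *\<^sub>R \<beta> i s"
    proof (rule separatedG[OF V(1)])
      show "\<beta> i (c *\<^sub>R s) \<in> sects G V (i + d)" using \<beta>[OF cs] by blast
      show "c *\<^sub>R \<beta> i s \<in> sects G V (i + d)"
        using subspace_scale[OF subspaceG[OF V(1)]] \<beta>[OF s] by blast
      fix x assume x: "x \<in> V"
      obtain W s' where 1: "opn W" "x \<in> W" "W \<subseteq> V" "s' \<in> sects F U i"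
        "restr F U W i s' = restr F V W i s" using near[OF x s] by blast
      have WU: "W \<subseteq> U" using 1 V by blast
      have "restr F U W i (c *\<^sub>R s') = restr F V W i (c *\<^sub>R s)"
        using lin_map_scale[OF restr_linF[OF U 1(1) WU] 1(4)]
          lin_map_scale[OF restr_linF[OF V(1) 1(1,3)] s] 1(5) by simp
      then have "restr G V W (i + d) (\<beta> i (c *\<^sub>R s)) = restr G U W (i + d) (\<alpha> i (c *\<^sub>R s'))"
        using \<beta>W[OF cs 1(1,3)] subspace_scale[OF subspaceF[OF U] 1(4)] by blast
      also have "\<dots> = c *\<^sub>R restr G U W (i + d) (\<alpha> i s')"
        using lin_map_scale[OF hom_lin[OF \<alpha>] 1(4)]
          lin_map_scale[OF restr_linG[OF U 1(1) WU] hom_in[OF \<alpha> 1(4)]] by simp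
      also have "\<dots> = c *\<^sub>R restr G V W (i + d) (\<beta> i s)"
        using \<beta>W[OF s 1(1,3,4,5)] by simp
      also have "\<dots> = restr G V W (i + d) (c *\<^sub>R \<beta> i s)"
        using lin_map_scale[OF restr_linG[OF V(1) 1(1,3)]] \<beta>[OF s] by simp
      finally show "\<exists>W. opn W \<and> x \<in> W \<and> W \<subseteq> V \<and>
        restr G V W (i + d) (\<beta> i (c *\<^sub>R s)) = restr G V W (i + d) (c *\<^sub>R \<beta> i s)"
        using 1 by blast
    qed
  qed
  have act: "\<beta> (j + i) (gact F V j i a s) = (-1) powi (j * d) *\<^sub>R gact G V j (i + d) a (\<beta> i s)"
    if a: "a \<in> sects A V j" and s: "s \<in> sects F V i" for j i a s
  proof (rule separatedG[OF V(1)])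
    \<comment> \<open>The scalar \<open>a\<close> also lives only over \<open>V\<close>; before
      linearity of \<open>\<alpha>\<close> applies, it has to be replaced near \<open>x\<close> by a
      scalar over \<open>U\<close>.\<close>
    interpret alg: module_pair A "alg_mod A" G
      using alg bumps graded_module_sheaf_alg_mod modG by unfold_locales
    have as: "gact F V j i a s \<in> sects F V (j + i)" by (rule gact_in[OF modF V(1) a s])
    note \<beta>s = conjunct1[OF \<beta>[OF s]]
    have a\<beta>: "gact G V j (i + d) a (\<beta> i s) \<in> sects G V (j + i + d)"
      using gact_in[OF modG V(1) a \<beta>s] by (simp add: add.assoc)
    show "\<beta> (j + i) (gact F V j i a s) \<in> sects G V (j + i + d)" using \<beta>[OF as] by blast
    show "(-1) powi (j * d) *\<^sub>R gact G V j (i + d) a (\<beta> i s) \<in> sects G V (j + i + d)"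
      using subspace_scale[OF subspaceG[OF V(1)] a\<beta>] .
    fix x assume x: "x \<in> V"
    obtain W1 s' where 1: "opn W1" "x \<in> W1" "W1 \<subseteq> V" "s' \<in> sects F U i"
      "restr F U W1 i s' = restr F V W1 i s" using near[OF x s] by blast
    obtain W2 a' where 2: "opn W2" "x \<in> W2" "W2 \<subseteq> V" "a' \<in> sects A U j"
      "restr A U W2 j a' = restr A V W2 j a"
      using alg.extend_near[OF U V x, of a j] a by auto
    let ?W = "W1 \<inter> W2"
    have W: "opn ?W" "?W \<subseteq> V" "?W \<subseteq> U" using 1 2 V by auto
    have s': "restr F U ?W i s' = restr F V ?W i s"
      using restr_restrF[OF U 1(1) W(1) _ _ 1(4)] restr_restrF[OF V(1) 1(1) W(1) _ _ s] 1 V by auto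
    have a': "restr A U ?W j a' = restr A V ?W j a"
      using restr_restr[OF shA U 2(1) W(1) _ _ 2(4)] restr_restr[OF shA V(1) 2(1) W(1) _ _ a] 2 V
      by auto
    note as' = gact_in[OF modF U 2(4) 1(4)] and \<alpha>s' = hom_in[OF \<alpha> 1(4)]
    have a\<alpha>: "gact G U j (i + d) a' (\<alpha> i s') \<in> sects G U (j + i + d)"
      using gact_in[OF modG U 2(4) \<alpha>s'] by (simp add: add.assoc)
    have "restr F U ?W (j + i) (gact F U j i a' s') = restr F V ?W (j + i) (gact F V j i a s)"
      using restr_gact[OF modF U W(1,3) 2(4) 1(4)] restr_gact[OF modF V(1) W(1,2) a s] s' a' by simp
    then have "restr G V ?W (j + i + d) (\<beta> (j + i) (gact F V j i a s)) =
        restr G U ?W (j + i + d) (\<alpha> (j + i) (gact F U j i a' s'))"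
      by (rule \<beta>W[OF as W(1,2) as'])
    also have "\<dots> = (-1) powi (j * d) *\<^sub>R restr G U ?W (j + i + d) (gact G U j (i + d) a' (\<alpha> i s'))"
      using hom_gact[OF \<alpha> 2(4) 1(4)] lin_map_scale[OF restr_linG[OF U W(1,3)] a\<alpha>] by simp
    also have "restr G U ?W (j + i + d) (gact G U j (i + d) a' (\<alpha> i s')) =
        restr G V ?W (j + i + d) (gact G V j (i + d) a (\<beta> i s))"
      using restr_gact[OF modG U W(1,3) 2(4) \<alpha>s'] restr_gact[OF modG V(1) W(1,2) a \<beta>s]
        \<beta>W[OF s W(1,2) 1(4) s'] a' by (simp add: add.assoc)
    also have "(-1) powi (j * d) *\<^sub>R \<dots> =
        restr G V ?W (j + i + d) ((-1) powi (j * d) *\<^sub>R gact G V j (i + d) a (\<beta> i s))"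
      using lin_map_scale[OF restr_linG[OF V(1) W(1,2)] a\<beta>] by simp
    finally show "\<exists>W. opn W \<and> x \<in> W \<and> W \<subseteq> V \<and>
        restr G V W (j + i + d) (\<beta> (j + i) (gact F V j i a s)) =
        restr G V W (j + i + d) ((-1) powi (j * d) *\<^sub>R gact G V j (i + d) a (\<beta> i s))"
      using W 1 2 by blast
  qed
  have "\<beta> \<in> hom_sects A F G V d"
    unfolding hom_sects_def using lin act by (auto simp: \<beta>_def)
  moreover have "compat U V d \<alpha> \<beta>"
    unfolding compat_def
  proof (intro allI ballI)
    fix i s assume s: "s \<in> sects F U i"
    have rs: "restr F U V i s \<in> sects F V i" by (rule restr_inF[OF U V s])
    \<comment> \<open>A section that comes from \<open>U\<close> is its own extension, with
      \<open>W = V\<close>.\<close>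
    have "restr G V V (i + d) (\<beta> i (restr F U V i s)) = restr G U V (i + d) (\<alpha> i s)"
      using \<beta>W[OF rs V(1) subset_refl s] restr_idF[OF V(1) rs] by simp
    then show "\<beta> i (restr F U V i s) = restr G U V (i + d) (\<alpha> i s)"
      using restr_idG[OF V(1)] \<beta>[OF rs] by simp
  qed
  ultimately show thesis using that by blast
qed

section \<open>The sheaf of homomorphisms\<close>

abbreviation "H \<equiv> hom_sheaf A F G"

text \<open>Eliminates the definite description: an identity for restrictions in \<open>H\<close> is
  proved by showing that the proposed map is compatible with \<open>\<alpha>\<close>.\<close>

lemma hom_restr_eq:
  assumes U: "opn U" and V: "opn V" "V \<subseteq> U"
    and \<beta>: "\<beta> \<in> hom_sects A F G V d" "compat U V d \<alpha> \<beta>"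
  shows "restr H U V d \<alpha> = \<beta>"
proof -
  have "restr H U V d \<alpha> = (THE \<beta>. \<beta> \<in> hom_sects A F G V d \<and> compat U V d \<alpha> \<beta>)"
    by (simp add: hom_sheaf_def compat_def)
  also have "\<dots> = \<beta>"
    using \<beta> compat_unique[OF U V] by (intro the_equality) auto
  finally show ?thesis .
qed

lemma
  assumes \<alpha>: "\<alpha> \<in> hom_sects A F G U d" and U: "opn U" and V: "opn V" "V \<subseteq> U"
  shows hom_restr_in: "restr H U V d \<alpha> \<in> hom_sects A F G V d"
    and hom_restr_compat: "compat U V d \<alpha> (restr H U V d \<alpha>)"
proof -
  obtain \<beta> where \<beta>: "\<beta> \<in> hom_sects A F G V d" "compat U V d \<alpha> \<beta>"
    by (rule compat_exists[OF \<alpha> U V])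
  then show "restr H U V d \<alpha> \<in> hom_sects A F G V d" "compat U V d \<alpha> (restr H U V d \<alpha>)"
    using hom_restr_eq[OF U V \<beta>] by auto
qed

lemmas hom_restr_apply = compatD[OF hom_restr_compat]

lemma hom_restr_id:
  assumes \<alpha>: "\<alpha> \<in> hom_sects A F G U d" and U: "opn U"
  shows "restr H U U d \<alpha> = \<alpha>"
proof (rule hom_restr_eq[OF U U subset_refl \<alpha>])
  show "compat U U d \<alpha> \<alpha>"
    unfolding compat_def using restr_idF[OF U] restr_idG[OF U hom_in[OF \<alpha>]] by auto
qed

lemma hom_restr_restr:
  assumes \<alpha>: "\<alpha> \<in> hom_sects A F G U d" and U: "opn U" and V: "opn V" "V \<subseteq> U"
    and W: "opn W" "W \<subseteq> V"
  shows "restr H V W d (restr H U V d \<alpha>) = restr H U W d \<alpha>"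
proof (rule hom_restr_eq[symmetric, OF U W(1) _ hom_restr_in[OF hom_restr_in[OF \<alpha> U V] V(1) W]])
  show "W \<subseteq> U" using V W by blast
  show "compat U W d \<alpha> (restr H V W d (restr H U V d \<alpha>))"
    unfolding compat_def
  proof (intro allI ballI)
    fix i s assume s: "s \<in> sects F U i"
    have "restr H V W d (restr H U V d \<alpha>) i (restr F U W i s) =
        restr H V W d (restr H U V d \<alpha>) i (restr F V W i (restr F U V i s))"
      using restr_restrF[OF U V(1) W V(2) s] by simp
    also have "\<dots> = restr G V W (i + d) (restr G U V (i + d) (\<alpha> i s))"
      using hom_restr_apply[OF hom_restr_in[OF \<alpha> U V] V(1) W restr_inF[OF U V s]]
        hom_restr_apply[OF \<alpha> U V s] by simp
    also have "\<dots> = restr G U W (i + d) (\<alpha> i s)"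
      by (rule restr_restrG[OF U V(1) W V(2) hom_in[OF \<alpha> s]])
    finally show "restr H V W d (restr H U V d \<alpha>) i (restr F U W i s) = restr G U W (i + d) (\<alpha> i s)" .
  qed
qed

lemma subspace_hom_sects:
  assumes U: "opn U"
  shows "subspace (hom_sects A F G U d)"
proof (rule subspaceI)
  have g0: "gact G U j k a 0 = 0" if "a \<in> sects A U j" for a j k
    by (rule lin_map_zero[OF subspaceG[OF U] gact_lin[OF modG U that]])
  show "0 \<in> hom_sects A F G U d"
    using g0 subspace_0[OF subspaceG[OF U]] by (auto simp: hom_sects_def lin_map_def)
next
  fix \<alpha> \<beta> assume \<alpha>: "\<alpha> \<in> hom_sects A F G U d" and \<beta>: "\<beta> \<in> hom_sects A F G U d"
  show "\<alpha> + \<beta> \<in> hom_sects A F G U d"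
    unfolding hom_sects_def lin_map_def
    using subspace_add[OF subspaceG[OF U] hom_in[OF \<alpha>] hom_in[OF \<beta>]]
      lin_map_add[OF hom_lin[OF \<alpha>]] lin_map_add[OF hom_lin[OF \<beta>]]
      lin_map_scale[OF hom_lin[OF \<alpha>]] lin_map_scale[OF hom_lin[OF \<beta>]]
      hom_gact[OF \<alpha>] hom_gact[OF \<beta>] hom_off[OF \<alpha>] hom_off[OF \<beta>]
      lin_map_add[OF gact_lin[OF modG U] hom_in[OF \<alpha>] hom_in[OF \<beta>]]
    by (auto simp: algebra_simps)
next
  fix c :: real and \<alpha> assume \<alpha>: "\<alpha> \<in> hom_sects A F G U d"
  show "c *\<^sub>R \<alpha> \<in> hom_sects A F G U d"
    unfolding hom_sects_def lin_map_def
    using subspace_scale[OF subspaceG[OF U] hom_in[OF \<alpha>]]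
      lin_map_add[OF hom_lin[OF \<alpha>]] lin_map_scale[OF hom_lin[OF \<alpha>]]
      hom_gact[OF \<alpha>] hom_off[OF \<alpha>]
      lin_map_scale[OF gact_lin[OF modG U] hom_in[OF \<alpha>]]
    by (auto simp: algebra_simps scaleR_fun_def)
qed

lemma hom_restr_lin:
  assumes U: "opn U" and V: "opn V" "V \<subseteq> U"
  shows "lin_map (hom_sects A F G U d) (hom_sects A F G V d) (restr H U V d)"
  unfolding lin_map_def
proof (intro conjI ballI allI)
  fix \<alpha> assume \<alpha>: "\<alpha> \<in> hom_sects A F G U d"
  note r\<alpha> = hom_restr_in[OF \<alpha> U V]
  show "restr H U V d \<alpha> \<in> hom_sects A F G V d" by (rule r\<alpha>)
  show "restr H U V d (c *\<^sub>R \<alpha>) = c *\<^sub>R restr H U V d \<alpha>" for c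
    using hom_restr_apply[OF \<alpha> U V] lin_map_scale[OF restr_linG[OF U V] hom_in[OF \<alpha>]]
    by (intro hom_restr_eq[OF U V] subspace_scale[OF subspace_hom_sects[OF V(1)]] r\<alpha>)
      (auto simp: compat_def scaleR_fun_def)
  fix \<beta> assume \<beta>: "\<beta> \<in> hom_sects A F G U d"
  show "restr H U V d (\<alpha> + \<beta>) = restr H U V d \<alpha> + restr H U V d \<beta>"
    using hom_restr_apply[OF \<alpha> U V] hom_restr_apply[OF \<beta> U V]
      lin_map_add[OF restr_linG[OF U V] hom_in[OF \<alpha>] hom_in[OF \<beta>]]
    by (intro hom_restr_eq[OF U V] subspace_add[OF subspace_hom_sects[OF V(1)]] r\<alpha>
        hom_restr_in[OF \<beta> U V]) (auto simp: compat_def)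
qed

text \<open>All laws of a homomorphism are equations between sections of \<open>G\<close>, so they
  may be verified on a cover, where \<open>t\<close> is given by honest homomorphisms. This is what
  gluing values argument by argument needs afterwards.\<close>

lemma hom_sectsI_local:
  assumes V: "opn V" and t: "\<And>i s. s \<in> sects F V i \<Longrightarrow> t i s \<in> sects G V (i + d)"
    and off: "\<And>i s. s \<notin> sects F V i \<Longrightarrow> t i s = 0"
    and loc: "\<And>x. x \<in> V \<Longrightarrow> \<exists>U \<alpha>. opn U \<and> x \<in> U \<and> U \<subseteq> V \<and> \<alpha> \<in> hom_sects A F G U d \<and>
      (\<forall>i. \<forall>s\<in>sects F V i. restr G V U (i + d) (t i s) = \<alpha> i (restr F V U i s))"
  shows "t \<in> hom_sects A F G V d"
proof -
  have "t i (s + s') = t i s + t i s'" if s: "s \<in> sects F V i" "s' \<in> sects F V i" for i s s'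
  proof (rule separatedG[OF V])
    note ss = subspace_add[OF subspaceF[OF V] s]
    show "t i (s + s') \<in> sects G V (i + d)" by (rule t[OF ss])
    show "t i s + t i s' \<in> sects G V (i + d)" by (intro subspace_add[OF subspaceG[OF V]] t s)
    fix x assume "x \<in> V"
    then obtain U \<alpha> where U: "opn U" "x \<in> U" "U \<subseteq> V" and \<alpha>: "\<alpha> \<in> hom_sects A F G U d"
      and eq: "\<And>i s. s \<in> sects F V i \<Longrightarrow> restr G V U (i + d) (t i s) = \<alpha> i (restr F V U i s)"
      using loc by metis
    have "restr G V U (i + d) (t i (s + s')) = restr G V U (i + d) (t i s + t i s')"
      using eq[OF ss] eq[OF s(1)] eq[OF s(2)] lin_map_add[OF restr_linF[OF V U(1,3)] s]
        lin_map_add[OF hom_lin[OF \<alpha>] restr_inF[OF V U(1,3) s(1)] restr_inF[OF V U(1,3) s(2)]]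
        lin_map_add[OF restr_linG[OF V U(1,3)] t[OF s(1)] t[OF s(2)]] by simp
    then show "\<exists>W. opn W \<and> x \<in> W \<and> W \<subseteq> V \<and>
        restr G V W (i + d) (t i (s + s')) = restr G V W (i + d) (t i s + t i s')"
      using U by blast
  qed
  moreover have "t i (c *\<^sub>R s) = c *\<^sub>R t i s" if s: "s \<in> sects F V i" for i s c
  proof (rule separatedG[OF V])
    note cs = subspace_scale[OF subspaceF[OF V] s, of c]
    show "t i (c *\<^sub>R s) \<in> sects G V (i + d)" by (rule t[OF cs])
    show "c *\<^sub>R t i s \<in> sects G V (i + d)" by (intro subspace_scale[OF subspaceG[OF V]] t s)
    fix x assume "x \<in> V"
    then obtain U \<alpha> where U: "opn U" "x \<in> U" "U \<subseteq> V" and \<alpha>: "\<alpha> \<in> hom_sects A F G U d"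
      and eq: "\<And>i s. s \<in> sects F V i \<Longrightarrow> restr G V U (i + d) (t i s) = \<alpha> i (restr F V U i s)"
      using loc by metis
    have "restr G V U (i + d) (t i (c *\<^sub>R s)) = restr G V U (i + d) (c *\<^sub>R t i s)"
      using eq[OF cs] eq[OF s(1)] lin_map_scale[OF restr_linF[OF V U(1,3)] s]
        lin_map_scale[OF hom_lin[OF \<alpha>] restr_inF[OF V U(1,3) s]]
        lin_map_scale[OF restr_linG[OF V U(1,3)] t[OF s]] by simp
    then show "\<exists>W. opn W \<and> x \<in> W \<and> W \<subseteq> V \<and>
        restr G V W (i + d) (t i (c *\<^sub>R s)) = restr G V W (i + d) (c *\<^sub>R t i s)"
      using U by blast
  qed
  moreover have "t (j + i) (gact F V j i a s) = (-1) powi (j * d) *\<^sub>R gact G V j (i + d) a (t i s)"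
    if a: "a \<in> sects A V j" and s: "s \<in> sects F V i" for j i a s
  proof (rule separatedG[OF V])
    note as = gact_in[OF modF V a s]
    have at: "gact G V j (i + d) a (t i s) \<in> sects G V (j + i + d)"
      using gact_in[OF modG V a t[OF s]] by (simp add: add.assoc)
    show "t (j + i) (gact F V j i a s) \<in> sects G V (j + i + d)" by (rule t[OF as])
    show "(-1) powi (j * d) *\<^sub>R gact G V j (i + d) a (t i s) \<in> sects G V (j + i + d)"
      by (rule subspace_scale[OF subspaceG[OF V] at])
    fix x assume "x \<in> V"
    then obtain U \<alpha> where U: "opn U" "x \<in> U" "U \<subseteq> V" and \<alpha>: "\<alpha> \<in> hom_sects A F G U d"
      and eq: "\<And>i s. s \<in> sects F V i \<Longrightarrow> restr G V U (i + d) (t i s) = \<alpha> i (restr F V U i s)"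
      using loc by metis
    note ra = restr_in[OF shA V U(1,3) a] and rs = restr_inF[OF V U(1,3) s]
    have "restr G V U (j + i + d) (t (j + i) (gact F V j i a s)) =
        (-1) powi (j * d) *\<^sub>R gact G U j (i + d) (restr A V U j a) (\<alpha> i (restr F V U i s))"
      using eq[OF as] restr_gact[OF modF V U(1,3) a s] hom_gact[OF \<alpha> ra rs] by simp
    also have "\<dots> = (-1) powi (j * d) *\<^sub>R restr G V U (j + i + d) (gact G V j (i + d) a (t i s))"
      using eq[OF s] restr_gact[OF modG V U(1,3) a t[OF s]] by (simp add: add.assoc)
    also have "\<dots> = restr G V U (j + i + d) ((-1) powi (j * d) *\<^sub>R gact G V j (i + d) a (t i s))"
      using lin_map_scale[OF restr_linG[OF V U(1,3)] at] by simp
    finally show "\<exists>W. opn W \<and> x \<in> W \<and> W \<subseteq> V \<and>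
        restr G V W (j + i + d) (t (j + i) (gact F V j i a s)) =
        restr G V W (j + i + d) ((-1) powi (j * d) *\<^sub>R gact G V j (i + d) a (t i s))"
      using U by blast
  qed
  ultimately show ?thesis
    using t off unfolding hom_sects_def lin_map_def by simp
qed

text \<open>Homomorphisms are glued through their values: for each fixed \<open>s\<close> the
  sections \<open>\<sigma> U i (restr F (\<Union>\<U>) U i s)\<close> form a compatible family in
  \<open>G\<close>.\<close>

lemma hom_glue:
  assumes \<U>: "\<And>U. U \<in> \<U> \<Longrightarrow> opn U \<and> \<sigma> U \<in> hom_sects A F G U d"
    and eq: "\<And>U V. U \<in> \<U> \<Longrightarrow> V \<in> \<U> \<Longrightarrow> restr H U (U \<inter> V) d (\<sigma> U) = restr H V (U \<inter> V) d (\<sigma> V)"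
  shows "\<exists>!t. t \<in> hom_sects A F G (\<Union>\<U>) d \<and> (\<forall>U\<in>\<U>. restr H (\<Union>\<U>) U d t = \<sigma> U)"
proof -
  let ?V = "\<Union>\<U>"
  have V: "opn ?V" using \<U> by blast
  have sub: "U \<subseteq> ?V" if "U \<in> \<U>" for U using that by blast
  have op: "opn U" and \<sigma>: "\<sigma> U \<in> hom_sects A F G U d" if "U \<in> \<U>" for U using \<U> that by auto
  have ex: "\<exists>t. t \<in> sects G ?V (i + d) \<and>
      (\<forall>U\<in>\<U>. restr G ?V U (i + d) t = \<sigma> U i (restr F ?V U i s))" if s: "s \<in> sects F ?V i" for i s
  proof -
    have rs: "restr F ?V U i s \<in> sects F U i" if "U \<in> \<U>" for U
      using restr_inF[OF V op[OF that] sub[OF that] s] .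
    \<comment> \<open>Both values, restricted to the overlap, are rewritten as a restricted
      homomorphism applied to the same section over the overlap; then \<open>eq\<close> compares
      them.\<close>
    have r: "restr G U (U \<inter> U') (i + d) (\<sigma> U i (restr F ?V U i s)) =
        restr H U (U \<inter> U') d (\<sigma> U) i (restr F ?V (U \<inter> U') i s)"
      and r': "restr G U' (U \<inter> U') (i + d) (\<sigma> U' i (restr F ?V U' i s)) =
        restr H U' (U \<inter> U') d (\<sigma> U') i (restr F ?V (U \<inter> U') i s)"
      if U: "U \<in> \<U>" "U' \<in> \<U>" for U U'
    proof -
      have I: "opn (U \<inter> U')" using op U by blast
      show "restr G U (U \<inter> U') (i + d) (\<sigma> U i (restr F ?V U i s)) =
          restr H U (U \<inter> U') d (\<sigma> U) i (restr F ?V (U \<inter> U') i s)"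
        using hom_restr_apply[OF \<sigma>[OF U(1)] op[OF U(1)] I _ rs[OF U(1)]]
          restr_restrF[OF V op[OF U(1)] I _ sub[OF U(1)] s] by simp
      show "restr G U' (U \<inter> U') (i + d) (\<sigma> U' i (restr F ?V U' i s)) =
          restr H U' (U \<inter> U') d (\<sigma> U') i (restr F ?V (U \<inter> U') i s)"
        using hom_restr_apply[OF \<sigma>[OF U(2)] op[OF U(2)] I _ rs[OF U(2)]]
          restr_restrF[OF V op[OF U(2)] I _ sub[OF U(2)] s] by simp
    qed
    have "\<exists>!t. t \<in> sects G ?V (i + d) \<and>
        (\<forall>U\<in>\<U>. restr G ?V U (i + d) t = \<sigma> U i (restr F ?V U i s))"
    proof (rule glue_family[OF shG])
      show "openin (base G) U \<and> \<sigma> U i (restr F ?V U i s) \<in> sects G U (i + d)" if "U \<in> \<U>" for U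
        using op[OF that] hom_in[OF \<sigma>[OF that] rs[OF that]] baseG by simp
      show "restr G U (U \<inter> U') (i + d) (\<sigma> U i (restr F ?V U i s)) =
          restr G U' (U \<inter> U') (i + d) (\<sigma> U' i (restr F ?V U' i s))"
        if "U \<in> \<U>" "U' \<in> \<U>" for U U'
        using r[OF that] r'[OF that] eq[OF that] by simp
    qed
    then show ?thesis by blast
  qed
  define t where "t i s = (if s \<in> sects F ?V i then SOME t. t \<in> sects G ?V (i + d) \<and>
      (\<forall>U\<in>\<U>. restr G ?V U (i + d) t = \<sigma> U i (restr F ?V U i s)) else 0)" for i s
  have t: "t i s \<in> sects G ?V (i + d) \<and>
      (\<forall>U\<in>\<U>. restr G ?V U (i + d) (t i s) = \<sigma> U i (restr F ?V U i s))"
    if "s \<in> sects F ?V i" for i s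
    unfolding t_def using someI_ex[OF ex[OF that]] that by simp
  have hom: "t \<in> hom_sects A F G ?V d"
  proof (rule hom_sectsI_local[OF V])
    show "t i s \<in> sects G ?V (i + d)" if "s \<in> sects F ?V i" for i s using t[OF that] by blast
    show "t i s = 0" if "s \<notin> sects F ?V i" for i s using that by (simp add: t_def)
    fix x assume "x \<in> ?V"
    then obtain U where U: "x \<in> U" "U \<in> \<U>" by blast
    then show "\<exists>U \<alpha>. opn U \<and> x \<in> U \<and> U \<subseteq> ?V \<and> \<alpha> \<in> hom_sects A F G U d \<and>
        (\<forall>i. \<forall>s\<in>sects F ?V i. restr G ?V U (i + d) (t i s) = \<alpha> i (restr F ?V U i s))"
      using op[OF U(2)] \<sigma>[OF U(2)] sub[OF U(2)] t
      by (intro exI[of _ U] exI[of _ "\<sigma> U"]) auto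
  qed
  have tr: "restr H ?V U d t = \<sigma> U" if "U \<in> \<U>" for U
    using t that by (intro hom_restr_eq[OF V op[OF that] sub[OF that] \<sigma>[OF that]])
      (auto simp: compat_def)
  show ?thesis
  proof (rule ex1I[of _ t])
    show "t \<in> hom_sects A F G ?V d \<and> (\<forall>U\<in>\<U>. restr H ?V U d t = \<sigma> U)" using hom tr by blast
    fix t' assume t': "t' \<in> hom_sects A F G ?V d \<and> (\<forall>U\<in>\<U>. restr H ?V U d t' = \<sigma> U)"
    show "t' = t"
    proof (rule hom_sects_eqI[OF conjunct1[OF t'] hom])
      fix i s assume s: "s \<in> sects F ?V i"
      show "t' i s = t i s"
      proof (rule separatedG[OF V hom_in[OF conjunct1[OF t'] s] hom_in[OF hom s]])
        fix x assume "x \<in> ?V"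
        then obtain U where U: "x \<in> U" "U \<in> \<U>" by blast
        have "restr G ?V U (i + d) (t' i s) = restr G ?V U (i + d) (t i s)"
          using hom_restr_apply[OF conjunct1[OF t'] V op[OF U(2)] sub[OF U(2)] s] t' U t[OF s] by simp
        then show "\<exists>W. opn W \<and> x \<in> W \<and> W \<subseteq> ?V \<and>
            restr G ?V W (i + d) (t' i s) = restr G ?V W (i + d) (t i s)"
          using U op[OF U(2)] sub[OF U(2)] by blast
      qed
    qed
  qed
qed

lemma graded_sheaf_hom: "graded_sheaf H"
  unfolding graded_sheaf_def hom_sheaf_simps baseF
proof (intro conjI allI impI ballI; (elim conjE)?)
  fix \<U> d \<sigma>
  assume "\<forall>U\<in>\<U>. opn U \<and> \<sigma> U \<in> hom_sects A F G U d"
    "\<forall>U\<in>\<U>. \<forall>V\<in>\<U>. restr H U (U \<inter> V) d (\<sigma> U) = restr H V (U \<inter> V) d (\<sigma> V)"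
  then show "\<exists>!t. t \<in> hom_sects A F G (\<Union>\<U>) d \<and> (\<forall>U\<in>\<U>. restr H (\<Union>\<U>) U d t = \<sigma> U)"
    by (intro hom_glue) auto
qed (simp_all add: subspace_hom_sects hom_restr_lin hom_restr_id hom_restr_restr)

text \<open>The sign is the point. Moving \<open>b\<close> of degree \<open>l\<close> out of
  \<open>\<alpha>\<close> costs \<open>(-1) powi (l * d)\<close>, and moving it past
  \<open>a\<close> costs \<open>(-1) powi (j * l)\<close> by graded commutativity; together this is
  the sign for degree \<open>j + d\<close>.\<close>

lemma hom_act_in:
  assumes U: "opn U" and a: "a \<in> sects A U j" and \<alpha>: "\<alpha> \<in> hom_sects A F G U d"
  shows "gact H U j d a \<alpha> \<in> hom_sects A F G U (j + d)"
proof -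
  let ?\<gamma> = "gact H U j d a \<alpha>"
  note lin = lin_map_add[OF gact_lin[OF modG U a] hom_in[OF \<alpha>] hom_in[OF \<alpha>]]
    lin_map_scale[OF gact_lin[OF modG U a] hom_in[OF \<alpha>]]
  have "gact G U j (i + d) a (\<alpha> i s) \<in> sects G U (i + (j + d))" if "s \<in> sects F U i" for i s
    using gact_in[OF modG U a hom_in[OF \<alpha> that]] by (simp add: add.left_commute)
  then have "lin_map (sects F U i) (sects G U (i + (j + d))) (?\<gamma> i)" for i
    unfolding lin_map_def
    using lin lin_map_add[OF hom_lin[OF \<alpha>]] lin_map_scale[OF hom_lin[OF \<alpha>]]
      subspace_add[OF subspaceF[OF U]] subspace_scale[OF subspaceF[OF U]] by simp
  moreover have "?\<gamma> (l + i) (gact F U l i b s) =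
      (-1) powi (l * (j + d)) *\<^sub>R gact G U l (i + (j + d)) b (?\<gamma> i s)"
    if b: "b \<in> sects A U l" and s: "s \<in> sects F U i" for l i b s
  proof -
    note \<alpha>s = hom_in[OF \<alpha> s]
    have b\<alpha>: "gact G U l (i + d) b (\<alpha> i s) \<in> sects G U (l + i + d)"
      using gact_in[OF modG U b \<alpha>s] by (simp add: add.assoc)
    have ba: "gmul A U l j b a \<in> sects A U (j + l)"
      using lin_map_in[OF gmul_lin[OF alg U b] a] by (simp add: add.commute)
    have "?\<gamma> (l + i) (gact F U l i b s) = gact G U j (l + i + d) a (\<alpha> (l + i) (gact F U l i b s))"
      using gact_in[OF modF U b s] by simp
    also have "\<dots> = (-1) powi (l * d) *\<^sub>R gact G U j (l + (i + d)) a (gact G U l (i + d) b (\<alpha> i s))"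
      using hom_gact[OF \<alpha> b s] lin_map_scale[OF gact_lin[OF modG U a] b\<alpha>] by (simp add: add.assoc)
    also have "\<dots> = (-1) powi (l * d) *\<^sub>R gact G U (j + l) (i + d) (gmul A U j l a b) (\<alpha> i s)"
      using gact_assoc[OF modG U a b \<alpha>s] by simp
    also have "\<dots> = (-1) powi (l * d) *\<^sub>R (-1) powi (j * l) *\<^sub>R
        gact G U (j + l) (i + d) (gmul A U l j b a) (\<alpha> i s)"
      using gmul_commute[OF alg U a b] lin_map_scale[OF gact_lin_left[OF modG U \<alpha>s] ba] by simp
    also have "\<dots> = (-1) powi (l * (j + d)) *\<^sub>R gact G U l (j + (i + d)) b (gact G U j (i + d) a (\<alpha> i s))"
      using gact_assoc[OF modG U b a \<alpha>s]
      by (simp add: power_int_add distrib_left mult.commute add.commute)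
    finally show ?thesis using s by (simp add: add.left_commute)
  qed
  ultimately show ?thesis
    unfolding hom_sects_def by simp
qed

lemma graded_module_sheaf_hom: "graded_module_sheaf A H"
  unfolding graded_module_sheaf_def
proof (intro conjI allI impI ballI; (elim conjE)?)
  show "base H = base A" by (simp add: baseF)
  show "graded_sheaf H" by (rule graded_sheaf_hom)
next
  fix U j d a assume U: "opn U" and a: "a \<in> sects A U j"
  show "lin_map (sects H U d) (sects H U (j + d)) (gact H U j d a)"
    unfolding lin_map_def hom_sheaf_simps(2)
  proof (intro conjI ballI allI)
    fix \<alpha> assume \<alpha>: "\<alpha> \<in> hom_sects A F G U d"
    show "gact H U j d a \<alpha> \<in> hom_sects A F G U (j + d)" by (rule hom_act_in[OF U a \<alpha>])
    show "gact H U j d a (c *\<^sub>R \<alpha>) = c *\<^sub>R gact H U j d a \<alpha>" for c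
      using lin_map_scale[OF gact_lin[OF modG U a] hom_in[OF \<alpha>]]
      by (auto simp: fun_eq_iff scaleR_fun_def)
    fix \<beta> assume \<beta>: "\<beta> \<in> hom_sects A F G U d"
    show "gact H U j d a (\<alpha> + \<beta>) = gact H U j d a \<alpha> + gact H U j d a \<beta>"
      using lin_map_add[OF gact_lin[OF modG U a] hom_in[OF \<alpha>] hom_in[OF \<beta>]]
      by (auto simp: fun_eq_iff)
  qed
next
  fix U j d \<alpha> assume U: "opn U" and "\<alpha> \<in> sects H U d"
  then have \<alpha>: "\<alpha> \<in> hom_sects A F G U d" by simp
  show "lin_map (sects A U j) (sects H U (j + d)) (\<lambda>a. gact H U j d a \<alpha>)"
    unfolding lin_map_def hom_sheaf_simps(2)
    using hom_act_in[OF U _ \<alpha>] lin_map_add[OF gact_lin_left[OF modG U hom_in[OF \<alpha>]]]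
      lin_map_scale[OF gact_lin_left[OF modG U hom_in[OF \<alpha>]]]
    by (auto simp: fun_eq_iff scaleR_fun_def)
next
  fix U i j k a b \<alpha> assume U: "opn U" and a: "a \<in> sects A U i" and b: "b \<in> sects A U j"
    and "\<alpha> \<in> sects H U k"
  then have \<alpha>: "\<alpha> \<in> hom_sects A F G U k" by simp
  show "gact H U (i + j) k (gmul A U i j a b) \<alpha> = gact H U i (j + k) a (gact H U j k b \<alpha>)"
    using gact_assoc[OF modG U a b hom_in[OF \<alpha>]] by (auto simp: fun_eq_iff add.left_commute)
next
  fix U k \<alpha> assume U: "opn U" and "\<alpha> \<in> sects H U k"
  then have \<alpha>: "\<alpha> \<in> hom_sects A F G U k" by simp
  show "gact H U 0 k (gone A U) \<alpha> = \<alpha>"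
    using gact_one[OF modG U hom_in[OF \<alpha>]] hom_off[OF \<alpha>] by (auto simp: fun_eq_iff)
next
  fix U V j k a \<alpha> assume U: "opn U" and V: "opn V" "V \<subseteq> U" and a: "a \<in> sects A U j"
    and "\<alpha> \<in> sects H U k"
  then have \<alpha>: "\<alpha> \<in> hom_sects A F G U k" by simp
  show "restr H U V (j + k) (gact H U j k a \<alpha>) = gact H V j k (restr A U V j a) (restr H U V k \<alpha>)"
  proof (rule hom_restr_eq[OF U V])
    show "gact H V j k (restr A U V j a) (restr H U V k \<alpha>) \<in> hom_sects A F G V (j + k)"
      by (rule hom_act_in[OF V(1) restr_in[OF shA U V a] hom_restr_in[OF \<alpha> U V]])
    show "compat U V (j + k) (gact H U j k a \<alpha>) (gact H V j k (restr A U V j a) (restr H U V k \<alpha>))"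
      unfolding compat_def
      using restr_inF[OF U V] hom_restr_apply[OF \<alpha> U V] restr_gact[OF modG U V a hom_in[OF \<alpha>]]
      by (simp add: add.left_commute)
  qed
qed

text \<open>Reads a morphism as a family of degree \<open>0\<close> sections of \<open>H\<close>
  related by restriction, the linearity sign being trivial in that degree. Since restrictions in
  \<open>H\<close> exist and are unique, the component over the whole space determines the others
  and can be prescribed.\<close>

lemma gmod_hom_iff:
  "gmod_hom A F G \<Lambda> \<longleftrightarrow>
    (\<forall>U. opn U \<longrightarrow> \<Lambda> U \<in> hom_sects A F G U 0) \<and>
    (\<forall>U V. opn U \<and> opn V \<and> V \<subseteq> U \<longrightarrow> compat U V 0 (\<Lambda> U) (\<Lambda> V)) \<and>
    (\<forall>U. \<not> opn U \<longrightarrow> \<Lambda> U = (\<lambda>i s. 0))"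
proof -
  have off: "(\<forall>U i s. \<not> (opn U \<and> s \<in> sects F U i) \<longrightarrow> \<Lambda> U i s = 0) \<longleftrightarrow>
      (\<forall>U. opn U \<longrightarrow> (\<forall>i s. s \<notin> sects F U i \<longrightarrow> \<Lambda> U i s = 0)) \<and>
      (\<forall>U. \<not> opn U \<longrightarrow> \<Lambda> U = (\<lambda>i s. 0))" (is "?L \<longleftrightarrow> ?R")
  proof
    show ?R if ?L using that by (simp add: fun_eq_iff)
    show ?L if R: ?R
    proof (intro allI impI)
      fix U i s assume "\<not> (opn U \<and> s \<in> sects F U i)"
      then show "\<Lambda> U i s = 0" using R by (cases "opn U") simp_all
    qed
  qed
  show ?thesis
    unfolding gmod_hom_def sheaf_hom_def compat_def hom_sects_def baseF baseG off by auto
qed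

lemma gmod_hom_restr:
  assumes "gmod_hom A F G \<Lambda>" and U: "opn U"
  shows "\<Lambda> U = restr H (topspace (base A)) U 0 (\<Lambda> (topspace (base A)))"
  using assms openin_subset[OF U]
  by (intro hom_restr_eq[symmetric] openin_topspace U) (auto simp: gmod_hom_iff)

lemma gmod_hom_unique:
  assumes "gmod_hom A F G \<Lambda>" "gmod_hom A F G \<Lambda>'"
    and "\<Lambda> (topspace (base A)) = \<Lambda>' (topspace (base A))"
  shows "\<Lambda> = \<Lambda>'"
proof
  fix U show "\<Lambda> U = \<Lambda>' U"
    using gmod_hom_restr[OF assms(1), of U] gmod_hom_restr[OF assms(2), of U] assms
    by (cases "opn U") (auto simp: gmod_hom_iff)
qed

lemma gmod_hom_exists:
  assumes L: "L \<in> hom_sects A F G (topspace (base A)) 0"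
  obtains \<Lambda> where "gmod_hom A F G \<Lambda>" "\<Lambda> (topspace (base A)) = L"
proof
  let ?X = "topspace (base A)"
  \<comment> \<open>The only possible choice: restrictions of \<open>L\<close> on open sets, and
    elsewhere the default required by \<open>sheaf_hom\<close>.\<close>
  let ?\<Lambda> = "\<lambda>U. if opn U then restr H ?X U 0 L else (\<lambda>i s. 0)"
  have X: "opn ?X" by simp
  have sub: "U \<subseteq> ?X" if "opn U" for U using openin_subset that by blast
  have "compat U V 0 (restr H ?X U 0 L) (restr H ?X V 0 L)" if "opn U" "opn V" "V \<subseteq> U" for U V
    using hom_restr_compat[OF hom_restr_in[OF L X that(1) sub] that]
      hom_restr_restr[OF L X that(1) sub that(2,3)] that by simp
  then show "gmod_hom A F G ?\<Lambda>"
    unfolding gmod_hom_iff using hom_restr_in[OF L X _ sub] by simp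
  show "?\<Lambda> ?X = L" using hom_restr_id[OF L X] by simp
qed

end

section \<open>Smooth functions on the real line\<close>

text \<open>The derivative is an existential witness instead of \<open>deriv\<close>, so that
  closure rules simply exhibit it, without separate differentiability conditions.\<close>

primrec Ck :: "nat \<Rightarrow> (real \<Rightarrow> real) \<Rightarrow> bool" where
  "Ck 0 f \<longleftrightarrow> continuous_on UNIV f"
| "Ck (Suc k) f \<longleftrightarrow> (\<exists>f'. (\<forall>x. (f has_real_derivative f' x) (at x)) \<and> Ck k f')"

lemma Ck_SucI:
  "(\<And>x. (f has_real_derivative f' x) (at x)) \<Longrightarrow> Ck k f' \<Longrightarrow> Ck (Suc k) f"
  by auto

lemma continuous_on_if_deriv:
  "(\<And>x. (f has_real_derivative f' x) (at x)) \<Longrightarrow> continuous_on UNIV f"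
  by (meson DERIV_isCont continuous_at_imp_continuous_on)

lemma Ck_imp_continuous: "Ck k f \<Longrightarrow> continuous_on UNIV f"
proof (cases k)
  case (Suc j)
  moreover assume "Ck k f"
  ultimately obtain f' where "\<And>x. (f has_real_derivative f' x) (at x)" by auto
  then show ?thesis by (rule continuous_on_if_deriv)
qed simp

text \<open>Needed for products and inverses, where the derivative combines \<open>f'\<close> of
  order \<open>k\<close> with \<open>f\<close> of order \<open>Suc k\<close>.\<close>

lemma Ck_SucD: "Ck (Suc k) f \<Longrightarrow> Ck k f"
proof (induction k arbitrary: f)
  case 0
  then show ?case using Ck_imp_continuous[of "Suc 0"] by simp
next
  case (Suc k)
  obtain f' where "\<forall>x. (f has_real_derivative f' x) (at x)" "Ck (Suc k) f'"
    using Suc.prems unfolding Ck.simps(2)[of "Suc k"] by blast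
  then show ?case using Suc.IH by auto
qed

lemma Ck_const: "Ck k (\<lambda>x. c)"
proof (induction k arbitrary: c)
  case (Suc k)
  then show ?case by (auto intro!: exI[of _ "\<lambda>x. 0"])
qed simp

lemma Ck_add: "Ck k f \<Longrightarrow> Ck k g \<Longrightarrow> Ck k (\<lambda>x. f x + g x)"
proof (induction k arbitrary: f g)
  case (Suc k)
  obtain f' g' where "\<forall>x. (f has_real_derivative f' x) (at x)" "Ck k f'"
    "\<forall>x. (g has_real_derivative g' x) (at x)" "Ck k g'"
    using Suc.prems by auto
  then show ?case
    using Suc.IH by (auto intro!: exI[of _ "\<lambda>x. f' x + g' x"] DERIV_add)
qed (auto intro: continuous_intros)

lemma Ck_mult: "Ck k f \<Longrightarrow> Ck k g \<Longrightarrow> Ck k (\<lambda>x. f x * g x)"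
proof (induction k arbitrary: f g)
  case (Suc k)
  obtain f' g' where *: "\<forall>x. (f has_real_derivative f' x) (at x)" "Ck k f'"
    "\<forall>x. (g has_real_derivative g' x) (at x)" "Ck k g'"
    using Suc.prems by auto
  have "Ck k (\<lambda>x. f' x * g x + g' x * f x)"
    using Suc.IH[OF *(2) Ck_SucD[OF Suc.prems(2)]] Suc.IH[OF *(4) Ck_SucD[OF Suc.prems(1)]]
    by (rule Ck_add)
  moreover have "((\<lambda>x. f x * g x) has_real_derivative f' x * g x + g' x * f x) (at x)" for x
    using DERIV_mult * by blast
  ultimately show ?case by (intro Ck_SucI)
qed (auto intro: continuous_intros)

lemma Ck_inverse:
  assumes nz: "\<And>x. f x \<noteq> 0"
  shows "Ck k f \<Longrightarrow> Ck k (\<lambda>x. inverse (f x))"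
proof (induction k)
  case 0
  then show ?case using nz by (auto intro!: continuous_intros)
next
  case (Suc k)
  obtain f' where *: "\<forall>x. (f has_real_derivative f' x) (at x)" "Ck k f'"
    using Suc.prems by auto
  have "Ck k (\<lambda>x. inverse (f x))" using Suc.IH Ck_SucD[OF Suc.prems] .
  then have "Ck k (\<lambda>x. (-1) * (inverse (f x) * f' x * inverse (f x)))"
    using * by (intro Ck_mult Ck_const)
  moreover have "((\<lambda>x. inverse (f x)) has_real_derivative
      (-1) * (inverse (f x) * f' x * inverse (f x))) (at x)" for x
    using DERIV_inverse'[OF *(1)[rule_format] nz] by simp
  ultimately show ?case by (intro Ck_SucI)
qed

lemma Ck_affine: "Ck k f \<Longrightarrow> Ck k (\<lambda>x. f (a + c * x))"
proof (induction k arbitrary: f)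
  case 0
  then show ?case by (auto intro!: continuous_on_compose2[of UNIV f] continuous_intros)
next
  case (Suc k)
  obtain f' where *: "\<forall>x. (f has_real_derivative f' x) (at x)" "Ck k f'"
    using Suc.prems by auto
  have "Ck k (\<lambda>x. f' (a + c * x) * c)"
    using Suc.IH[OF *(2)] by (intro Ck_mult Ck_const)
  moreover have "((\<lambda>x. f (a + c * x)) has_real_derivative f' (a + c * x) * c) (at x)" for x
    by (rule DERIV_chain2[OF *(1)[rule_format]]) (auto intro!: derivative_eq_intros)
  ultimately show ?case by (intro Ck_SucI)
qed

text \<open>\<open>flat 0\<close> is the classical function exp(-1/x), continued by zero. The powers
  of 1/x make the family closed under differentiation up to linear combinations, which gives
  smoothness by induction for all \<open>n\<close> at once.\<close>

definition flat :: "nat \<Rightarrow> real \<Rightarrow> real"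
  where "flat n x = (if x > 0 then (1 / x) ^ n * exp (- 1 / x) else 0)"

lemma flat_tendsto_0: "(flat n \<longlongrightarrow> 0) (at 0)"
proof (rule filterlim_split_at)
  show "(flat n \<longlongrightarrow> 0) (at_left 0)"
    by (rule Lim_transform_eventually[OF tendsto_const])
      (auto simp: flat_def eventually_at_filter)
  have "((\<lambda>x. inverse x ^ n / exp (inverse x)) \<longlongrightarrow> (0::real)) (at_right 0)"
    by (rule filterlim_compose[OF tendsto_power_div_exp_0 filterlim_inverse_at_top_right])
  then show "(flat n \<longlongrightarrow> 0) (at_right 0)"
    by (rule Lim_transform_eventually)
      (auto simp: flat_def eventually_at_filter divide_simps exp_minus)
qed

lemma flat_deriv:
  "(flat n has_real_derivative (- real n * flat (Suc n) x + flat (Suc (Suc n)) x)) (at x)"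
proof -
  consider "x > 0" | "x < 0" | "x = 0" by linarith
  then show ?thesis
  proof cases
    case 1
    have "((\<lambda>x. (1 / x) ^ n * exp (- 1 / x)) has_real_derivative
        (- real n * flat (Suc n) x + flat (Suc (Suc n)) x)) (at x)"
      using 1
      by (cases n) (auto intro!: derivative_eq_intros simp: flat_def field_simps power2_eq_square,
        metis One_nat_def power_eq_if)
    then show ?thesis
      using 1 by (elim has_field_derivative_transform_within_open[where S = "{0<..}"])
        (auto simp: flat_def)
  next
    case 2
    have "((\<lambda>x. 0) has_real_derivative 0) (at x)" by simp
    then show ?thesis
      using 2 by (subst has_field_derivative_transform_within_open[where S = "{..<0}" and f = "\<lambda>x. 0"])
        (auto simp: flat_def)
  next
    case 3
    \<comment> \<open>At the origin the difference quotient is again a member of the family, so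
      \<open>flat_tendsto_0\<close> gives the derivative \<open>0\<close>.\<close>
    have "(\<lambda>h. (flat n (0 + h) - flat n 0) / h) = flat (Suc n)"
      by (auto simp: flat_def fun_eq_iff)
    then show ?thesis
      using flat_tendsto_0[of "Suc n"] 3 by (simp add: DERIV_def) (simp add: flat_def)
  qed
qed

lemma Ck_flat: "Ck k (flat n)"
proof (induction k arbitrary: n)
  case 0
  show ?case using continuous_on_if_deriv[OF flat_deriv] by simp
next
  case (Suc k)
  have "Ck k (\<lambda>x. - real n * flat (Suc n) x + flat (Suc (Suc n)) x)"
    using Suc.IH by (intro Ck_add Ck_mult Ck_const)
  with flat_deriv show ?case by (rule Ck_SucI)
qed

lemma smooth_plateau:
  fixes c \<epsilon> :: real
  assumes "\<epsilon> > 0"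
  obtains b where "\<And>k. Ck k b" "\<And>t. \<bar>t - c\<bar> < \<epsilon> / 3 \<Longrightarrow> b t = 1" "\<And>t. \<bar>t - c\<bar> \<ge> \<epsilon> \<Longrightarrow> b t = 0"
proof
  \<comment> \<open>A smooth step from \<open>0\<close> to \<open>1\<close> on the unit interval.
    The denominator is positive, as \<open>x\<close> or \<open>1 - x\<close> is; the form
    \<open>1 + (-1) * x\<close> fits \<open>Ck_affine\<close>.\<close>
  define step where "step x = flat 0 x * inverse (flat 0 x + flat 0 (1 + (-1) * x))" for x
  have Ck: "Ck k step" for k
    unfolding step_def
    by (intro Ck_mult Ck_inverse Ck_add Ck_affine Ck_flat)
      (auto simp: flat_def add_nonneg_eq_0_iff add_pos_pos)
  have step1: "step x = 1" if "x \<ge> 1" for x using that by (simp add: step_def flat_def)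
  have step0: "step x = 0" if "x \<le> 0" for x using that by (simp add: step_def flat_def)
  \<comment> \<open>With u = (t - c) / \<epsilon> the arguments are 2 + 3u and 2 - 3u: both exceed 1
    if |u| < 1/3, and one of them is negative if |u| \<ge> 1.\<close>
  define b where "b t = step ((2 - 3 / \<epsilon> * c) + 3 / \<epsilon> * t) * step ((2 + 3 / \<epsilon> * c) + (- 3 / \<epsilon>) * t)" for t
  show "Ck k b" for k unfolding b_def by (intro Ck_mult Ck_affine Ck)
  have arg: "(2 - 3 / \<epsilon> * c) + 3 / \<epsilon> * t = 2 + 3 * ((t - c) / \<epsilon>)"
    "(2 + 3 / \<epsilon> * c) + (- 3 / \<epsilon>) * t = 2 - 3 * ((t - c) / \<epsilon>)" for t
    using assms by (auto simp: field_simps)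
  show "b t = 1" if "\<bar>t - c\<bar> < \<epsilon> / 3" for t
  proof -
    have "\<bar>(t - c) / \<epsilon>\<bar> < 1 / 3" using that assms by (simp add: field_simps)
    then show ?thesis unfolding b_def arg by (subst (1 2) step1) linarith+
  qed
  show "b t = 0" if "\<bar>t - c\<bar> \<ge> \<epsilon>" for t
  proof -
    have "\<bar>(t - c) / \<epsilon>\<bar> \<ge> 1" using that assms by (simp add: field_simps)
    then have "2 + 3 * ((t - c) / \<epsilon>) \<le> 0 \<or> 2 - 3 * ((t - c) / \<epsilon>) \<le> 0" by linarith
    then show ?thesis unfolding b_def arg using step0 by auto
  qed
qed

section \<open>Bump functions on a graded manifold\<close>

text \<open>A partial derivative replaces one factor by its derivative, so this class of products is
  stable and induction on \<open>r\<close> works for arbitrary \<open>f\<close> and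
  \<open>b\<close>. The formula is assumed on the whole space, so that it can be differentiated at
  points of \<open>U\<close> without regard to neighbourhoods. The constant \<open>a\<close> makes
  zero an instance even for \<open>n = 0\<close>, where the product is \<open>1\<close>.\<close>

lemma C_order_prod:
  assumes "\<And>i k. Ck k (b i)" "\<And>x. x \<in> topspace (Euclidean_space n) \<Longrightarrow> f x = a * (\<Prod>i<n. b i (x i))"
    and U: "U \<subseteq> topspace (Euclidean_space n)"
  shows "C_order n r U f"
  using assms(1,2)
proof (induction r arbitrary: f b)
  case (0 f b)
  have c: "continuous_map (subtopology (Euclidean_space n) U) euclideanreal (\<lambda>x. b i (x i))" for i
  proof -
    have "continuous_on UNIV (\<lambda>x::nat \<Rightarrow> real. b i (x i))"
      by (rule continuous_on_compose2[of UNIV "b i"])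
        (use Ck_imp_continuous[OF 0(1)] in \<open>auto intro: continuous_on_product_coordinates\<close>)
    then show ?thesis
      unfolding Euclidean_space_def euclidean_product_topology
      by (intro continuous_map_from_subtopology) simp
  qed
  have "continuous_map (subtopology (Euclidean_space n) U) euclideanreal (\<lambda>x. a * (\<Prod>i<n. b i (x i)))"
    by (intro continuous_map_real_mult continuous_map_prod[where f = "\<lambda>x i. b i (x i)"]
        finite_lessThan c continuous_map_const[THEN iffD2]) simp
  then show ?case
    using 0(2) by (auto elim!: continuous_map_eq)
next
  case (Suc r f b)
  have "C_order n 0 U f" using Suc.IH[OF Suc.prems] by (cases r) auto
  moreover have "((\<lambda>t. f (x(i := t))) has_real_derivative
      a * (\<Prod>j<n. (b(i := deriv (b i))) j (x j))) (at (x i))"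
    if i: "i < n" and x: "x \<in> topspace (Euclidean_space n)" for i x
  proof -
    have split: "(\<Prod>j<n. g j) = g i * (\<Prod>j\<in>{..<n} - {i}. g j)" for g :: "nat \<Rightarrow> real"
      using i by (subst prod.remove[of _ i]) auto
    have "f (x(i := t)) = b i t * (a * (\<Prod>j\<in>{..<n} - {i}. b j (x j)))" for t
    proof -
      have "x(i := t) \<in> topspace (Euclidean_space n)"
        using x i by (auto simp: topspace_Euclidean_space)
      then have "f (x(i := t)) = a * (\<Prod>j<n. b j ((x(i := t)) j))" by (rule Suc.prems(2))
      also have "\<dots> = b i t * (a * (\<Prod>j\<in>{..<n} - {i}. b j ((x(i := t)) j)))"
        by (subst split) simp
      also have "(\<Prod>j\<in>{..<n} - {i}. b j ((x(i := t)) j)) = (\<Prod>j\<in>{..<n} - {i}. b j (x j))"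
        by (intro prod.cong) auto
      finally show ?thesis .
    qed
    moreover have "(b i has_real_derivative deriv (b i) (x i)) (at (x i))"
    proof -
      obtain f' where "(b i has_real_derivative f') (at (x i))"
        using Suc.prems(1)[where k = "Suc 0" and i = i] by auto
      then show ?thesis using DERIV_imp_deriv by metis
    qed
    moreover have "a * (\<Prod>j<n. (b(i := deriv (b i))) j (x j)) =
        deriv (b i) (x i) * (a * (\<Prod>j\<in>{..<n} - {i}. b j (x j)))"
      by (subst split) (auto intro!: prod.cong)
    ultimately show ?thesis by (simp only: DERIV_cmult_right)
  qed
  note D = this
  have "C_order n r U (partial_deriv i f)" if "i < n" for i
  proof (rule Suc.IH)
    show "Ck k ((b(i := deriv (b i))) j)" for j k
    proof (cases "j = i")
      case True
      obtain f' where "\<forall>x. (b i has_real_derivative f' x) (at x)" "Ck k f'"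
        using Suc.prems(1)[where k = "Suc k" and i = i] by auto
      moreover from this have "deriv (b i) = f'" using DERIV_imp_deriv by blast
      ultimately show ?thesis using True by simp
    qed (use Suc.prems in simp)
    show "partial_deriv i f x = a * (\<Prod>j<n. (b(i := deriv (b i))) j (x j))"
      if "x \<in> topspace (Euclidean_space n)" for x
      unfolding partial_deriv_def by (rule DERIV_imp_deriv[OF D[OF \<open>i < n\<close> that]])
  qed
  ultimately show ?case
    using U D unfolding C_order.simps field_differentiable_def by (meson subsetD)
qed

section \<open>Boxes in Euclidean space\<close>

lemma Euclidean_space_box:
  assumes W: "openin (Euclidean_space n) W" and y: "y \<in> W"
  obtains \<epsilon> where "\<epsilon> > 0" "{z \<in> topspace (Euclidean_space n). \<forall>i<n. \<bar>z i - y i\<bar> \<le> \<epsilon>} \<subseteq> W"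
proof -
  obtain T where T: "openin (powertop_real UNIV) T" "W = T \<inter> {x. \<forall>i\<ge>n. x i = 0}"
    using W unfolding Euclidean_space_def openin_subtopology by blast
  have "y \<in> T" using y T(2) by blast
  then obtain B where B: "finite {i \<in> UNIV. B i \<noteq> topspace euclideanreal} \<and>
      (\<forall>i\<in>UNIV. openin euclideanreal (B i)) \<and> y \<in> Pi\<^sub>E UNIV B \<and> Pi\<^sub>E UNIV B \<subseteq> T"
    using T(1)[unfolded openin_product_topology_alt, THEN bspec, OF \<open>y \<in> T\<close>] by (elim exE)
  then have B: "open (B i)" "y \<in> Pi\<^sub>E UNIV B" "Pi\<^sub>E UNIV B \<subseteq> T" for i
    by simp_all
  have "\<exists>e>0. cball (y i) e \<subseteq> B i" for i
    using B(1)[of i] PiE_mem[OF B(2), of i] unfolding open_contains_cball by blast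
  then obtain e where e: "\<And>i. e i > 0" "\<And>i. cball (y i) (e i) \<subseteq> B i" by metis
  \<comment> \<open>The inserted \<open>1\<close> keeps the set nonempty for \<open>n = 0\<close>.
    Coordinates from \<open>n\<close> on are zero and impose no bound.\<close>
  define \<epsilon> where "\<epsilon> = Min (insert 1 (e ` {..<n}))"
  have \<epsilon>: "\<epsilon> > 0" "\<epsilon> \<le> e i" if "i < n" for i using e that by (auto simp: \<epsilon>_def)
  have "\<epsilon> > 0" using e by (auto simp: \<epsilon>_def)
  moreover have "{z \<in> topspace (Euclidean_space n). \<forall>i<n. \<bar>z i - y i\<bar> \<le> \<epsilon>} \<subseteq> W"
  proof
    fix z assume z: "z \<in> {z \<in> topspace (Euclidean_space n). \<forall>i<n. \<bar>z i - y i\<bar> \<le> \<epsilon>}"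
    have "z i \<in> B i" for i
    proof (cases "i < n")
      case True
      then have "z i \<in> cball (y i) (e i)"
        using z \<epsilon>(2)[OF True] by (auto simp: dist_real_def abs_minus_commute)
      then show ?thesis using e by blast
    next
      case False
      then have "z i = y i" using z y T by (auto simp: topspace_Euclidean_space)
      then show ?thesis using B(2) by auto
    qed
    then show "z \<in> W" using z B(3) T by (auto simp: topspace_Euclidean_space)
  qed
  ultimately show thesis using that by blast
qed

text \<open>The box is a full product, of intervals before position \<open>n\<close> and of
  \<open>{0}\<close> from there on, so Tychonoff's theorem applies.\<close>

lemma compactin_Euclidean_space_box:
  "compactin (Euclidean_space n) {z \<in> topspace (Euclidean_space n). \<forall>i<n. \<bar>z i - y i\<bar> \<le> \<epsilon>}"
proof -
  let ?S = "\<lambda>i. if i < n then {y i - \<epsilon>..y i + \<epsilon>} else {0}"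
  have "{z \<in> topspace (Euclidean_space n). \<forall>i<n. \<bar>z i - y i\<bar> \<le> \<epsilon>} = Pi\<^sub>E UNIV ?S"
    by (auto simp: topspace_Euclidean_space PiE_iff abs_le_iff split: if_splits)
      (smt (verit) not_le)+
  moreover have "compactin (powertop_real UNIV) (Pi\<^sub>E UNIV ?S)"
    by (simp add: compactin_PiE)
  ultimately show ?thesis
    unfolding Euclidean_space_def by (auto simp: compactin_subtopology)
qed

lemma openin_Euclidean_space_box:
  "openin (Euclidean_space n) {z \<in> topspace (Euclidean_space n). \<forall>i<n. \<bar>z i - y i\<bar> < \<epsilon>}"
proof -
  have "open {z :: nat \<Rightarrow> real. \<forall>i\<in>{..<n}. \<bar>z i - y i\<bar> < \<epsilon>}"
    unfolding Collect_ball_eq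
    by (intro open_INT ballI open_Collect_less continuous_intros finite_lessThan)
      (auto intro: continuous_on_product_coordinates)
  then show ?thesis
    unfolding Euclidean_space_def openin_subtopology euclidean_product_topology
    by (intro exI[of _ "{z. \<forall>i\<in>{..<n}. \<bar>z i - y i\<bar> < \<epsilon>}"]) auto
qed

text \<open>The support is enclosed in a compact set \<open>K\<close>, not merely in a closed one:
  compactness survives the passage from the chart to the manifold.\<close>

lemma model_bump:
  assumes B: "openin (Euclidean_space (m 0)) B" "B \<subseteq> W" "y \<in> B"
    and W: "openin (Euclidean_space (m 0)) W"
  obtains \<rho> T K where "\<rho> \<in> sects (model_sheaf m) W 0"
    "openin (Euclidean_space (m 0)) T" "y \<in> T" "T \<subseteq> K"
    "restr (model_sheaf m) W T 0 \<rho> = gone (model_sheaf m) T"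
    "compactin (Euclidean_space (m 0)) K" "K \<subseteq> B"
    "restr (model_sheaf m) W (W - K) 0 \<rho> = (\<lambda>p x. 0)"
proof -
  let ?E = "topspace (Euclidean_space (m 0))"
  obtain \<epsilon> where \<epsilon>: "\<epsilon> > 0" "{z \<in> ?E. \<forall>i<m 0. \<bar>z i - y i\<bar> \<le> \<epsilon>} \<subseteq> B"
    by (rule Euclidean_space_box[OF B(1,3)])
  have "\<exists>b. (\<forall>k. Ck k b) \<and> (\<forall>t. \<bar>t - c\<bar> < \<epsilon> / 3 \<longrightarrow> b t = 1) \<and> (\<forall>t. \<bar>t - c\<bar> \<ge> \<epsilon> \<longrightarrow> b t = 0)"
    for c
    by (rule smooth_plateau[OF \<epsilon>(1), of c]) blast
  then obtain b where b: "\<And>c k. Ck k (b c)" "\<And>c t. \<bar>t - c\<bar> < \<epsilon> / 3 \<Longrightarrow> b c t = 1"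
    "\<And>c t. \<bar>t - c\<bar> \<ge> \<epsilon> \<Longrightarrow> b c t = 0" by metis
  define g where "g x = (\<Prod>i<m 0. b (y i) (x i))" for x :: "nat \<Rightarrow> real"
  \<comment> \<open>Only the coefficient of the trivial monomial is nonzero, so the series has
    degree \<open>0\<close>.\<close>
  define \<rho> where "\<rho> p x = (if p = (\<lambda>v. 0) \<and> x \<in> W then g x else 0)"
    for p :: "int \<times> nat \<Rightarrow> nat" and x
  define K where "K = {z \<in> ?E. \<forall>i<m 0. \<bar>z i - y i\<bar> \<le> \<epsilon>}"
  define T where "T = {z \<in> ?E. \<forall>i<m 0. \<bar>z i - y i\<bar> < \<epsilon> / 3}"
  have WE: "W \<subseteq> ?E" using openin_subset[OF W] .
  have TK: "T \<subseteq> K" using \<epsilon>(1) by (fastforce simp: T_def K_def)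
  have KB: "K \<subseteq> B" using \<epsilon> by (simp add: K_def)
  have g1: "g x = 1" if "x \<in> T" for x
    using that b(2) by (auto simp: g_def T_def intro!: prod.neutral)
  have g0: "g x = 0" if x: "x \<in> ?E - K" for x
  proof -
    obtain i where "i < m 0" "\<bar>x i - y i\<bar> > \<epsilon>"
      using x by (auto simp: K_def not_le)
    then show ?thesis using b(3) by (auto simp: g_def intro!: bexI[of _ i])
  qed
  show thesis
  proof
    have "C_infinity (m 0) W (\<rho> p)" for p
      unfolding C_infinity_def
    proof
      fix r
      \<comment> \<open>Cutting off at \<open>W\<close> keeps the product formula valid on the whole
        space, because \<open>g\<close> already vanishes outside \<open>K\<close>, a subset of
        \<open>W\<close>.\<close>
      show "C_order (m 0) r W (\<rho> p)"
        using g0 KB B(2)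
        by (intro C_order_prod[OF b(1) _ WE, where a = "if p = (\<lambda>v. 0) then 1 else 0"])
          (auto simp: \<rho>_def g_def)
    qed
    moreover have "(\<lambda>v. 0) \<in> multi_indices m 0" by (simp add: multi_indices_def)
    ultimately show "\<rho> \<in> sects (model_sheaf m) W 0"
      by (auto simp: model_sheaf_def \<rho>_def intro!: ext)
    show "openin (Euclidean_space (m 0)) T" unfolding T_def by (rule openin_Euclidean_space_box)
    show "y \<in> T" using B openin_subset[OF B(1)] \<epsilon>(1) by (auto simp: T_def)
    show "restr (model_sheaf m) W T 0 \<rho> = gone (model_sheaf m) T"
      using TK KB B(2) g1 by (auto simp: model_sheaf_def \<rho>_def fun_eq_iff)
    show "compactin (Euclidean_space (m 0)) K"
      unfolding K_def by (rule compactin_Euclidean_space_box)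
    show "restr (model_sheaf m) W (W - K) 0 \<rho> = (\<lambda>p x. 0)"
      using g0 WE by (auto simp: model_sheaf_def \<rho>_def fun_eq_iff)
  qed (use TK KB in auto)
qed

text \<open>The isomorphism \<open>\<Phi>\<close> carries a model bump function to \<open>U\<close>.
  Being natural, unital and linear, it preserves where the function is the unit and where it is
  zero; gluing with \<open>0\<close> outside the support then makes it global.\<close>

lemma manifold_has_bumps:
  assumes "graded_manifold m M"
  shows "has_bumps M"
  unfolding has_bumps_def
proof (intro allI impI, elim conjE)
  fix V x assume V: "openin (base M) V" and x: "x \<in> V"
  let ?X = "topspace (base M)" and ?E = "Euclidean_space (m 0)" and ?A = "model_sheaf m"
  have Haus: "Hausdorff_space (base M)" and alg: "graded_algebra_sheaf M"
    and charts: "\<forall>x\<in>?X. \<exists>U h. x \<in> U \<and> underlying_chart m M U h"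
    using assms unfolding graded_manifold_def by auto
  note sh = graded_algebra_sheaf_sheaf[OF alg]
  have "x \<in> ?X" using V x openin_subset by blast
  then obtain U h where xU: "x \<in> U" and "underlying_chart m M U h" using charts by blast
  then obtain W \<Phi> where U: "openin (base M) U" and W: "openin ?E W"
    and h: "homeomorphic_map (subtopology (base M) U) (subtopology ?E W) h"
    and iso: "galg_iso (restrict_open ?A W)
      (pushforward_alg (subtopology ?E W) h (restrict_open M U)) \<Phi>"
    unfolding underlying_chart_def by blast
  have UX: "U \<subseteq> ?X" and WE: "W \<subseteq> topspace ?E" using U W openin_subset by auto
  have topU: "topspace (subtopology (base M) U) = U" using UX by auto
  have topW: "topspace (subtopology ?E W) = W" using WE by auto
  have baseA: "base ?A = ?E" by (simp add: model_sheaf_def)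
  define P where "P Z = {x \<in> U. h x \<in> Z}" for Z
  have inj: "inj_on h U" and surj: "h ` U = W"
    using homeomorphic_imp_injective_map[OF h] homeomorphic_imp_surjective_map[OF h] topU topW by auto
  have cont: "continuous_map (subtopology (base M) U) (subtopology ?E W) h"
    using homeomorphic_imp_continuous_map[OF h] .
  have PW: "P W = U" using surj by (auto simp: P_def)
  have Popen: "openin (base M) (P Z)" if "openin ?E Z" "Z \<subseteq> W" for Z
  proof -
    have "openin (subtopology ?E W) Z" using that openin_open_subtopology[OF W] by blast
    from openin_continuous_map_preimage[OF cont this, unfolded topU]
    have "openin (subtopology (base M) U) (P Z)" unfolding P_def .
    then show ?thesis using openin_open_subtopology[OF U] by blast
  qed
  have preim: "preim (subtopology (base M) U) h = P"
    unfolding preim_def P_def topU ..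
  have hom: "sheaf_hom (restrict_open ?A W)
      (pushforward_alg (subtopology ?E W) h (restrict_open M U)) \<Phi>"
    and one: "\<And>Z. openin (subtopology ?E W) Z \<Longrightarrow> \<Phi> Z 0 (gone ?A Z) = gone M (P Z)"
    using iso unfolding galg_iso_def galg_hom_def
    by (simp_all add: restrict_open_def pushforward_alg_def preim baseA)
  have lin: "lin_map (sects ?A Z k) (sects M (P Z) k) (\<Phi> Z k)"
    if "openin (subtopology ?E W) Z" for Z k
    using hom that unfolding sheaf_hom_def
    by (simp add: restrict_open_def pushforward_alg_def preim baseA)
  have nat: "\<Phi> Z k (restr ?A W Z k s) = restr M U (P Z) k (\<Phi> W k s)"
    if "openin (subtopology ?E W) Z" "s \<in> sects ?A W k" for Z k s
  proof -
    have "openin (subtopology ?E W) W" using topW by (metis openin_topspace)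
    then show ?thesis
      using hom that PW openin_subset[OF that(1)] topW unfolding sheaf_hom_def
      by (simp add: restrict_open_def pushforward_alg_def preim baseA)
  qed
  \<comment> \<open>Confining the support to the image of \<open>V\<close> ensures that it lands in
    \<open>V\<close> again.\<close>
  define B where "B = h ` (U \<inter> V)"
  have "openin (subtopology (base M) U) (U \<inter> V)"
    using U V openin_open_subtopology[OF U] by (simp add: openin_Int)
  then have "openin (subtopology ?E W) B"
    unfolding B_def using homeomorphic_imp_open_map[OF h] by (simp add: open_map_def)
  then have B: "openin ?E B" "B \<subseteq> W" using openin_open_subtopology[OF W] by auto
  have hx: "h x \<in> B" using x xU by (simp add: B_def)
  obtain \<rho> T K where \<rho>: "\<rho> \<in> sects ?A W 0" and T: "openin ?E T" "h x \<in> T" "T \<subseteq> K"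
    and \<rho>T: "restr ?A W T 0 \<rho> = gone ?A T" and K: "compactin ?E K" "K \<subseteq> B"
    and \<rho>K: "restr ?A W (W - K) 0 \<rho> = (\<lambda>p x. 0)"
    by (rule model_bump[of m B W "h x", OF B hx W])
  have TW: "T \<subseteq> W" using T K B by blast
  have KW: "K \<subseteq> W" using K B by blast
  have "openin ?E (W - K)"
    using compactin_imp_closedin[OF Hausdorff_Euclidean_space K(1)] W by (simp add: openin_diff)
  then have oT: "openin (subtopology ?E W) T" and oK: "openin (subtopology ?E W) (W - K)"
    using T TW openin_open_subtopology[OF W] by auto
  have oW: "openin (subtopology ?E W) W" using topW by (metis openin_topspace)
  define r where "r = \<Phi> W 0 \<rho>"
  have r: "r \<in> sects M U 0" using lin_map_in[OF lin[OF oW] \<rho>] PW by (simp add: r_def)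
  have rT: "restr M U (P T) 0 r = gone M (P T)"
    using nat[OF oT \<rho>] \<rho>T one[OF oT] by (simp add: r_def)
  have "restr M U (P (W - K)) 0 r = \<Phi> (W - K) 0 (\<lambda>p x. 0)"
    using nat[OF oK \<rho>] \<rho>K by (simp add: r_def)
  also have "\<dots> = 0"
  proof -
    \<comment> \<open>Linearity of \<open>\<Phi>\<close> is known on sections only, so the zero
      series must first be seen to be one.\<close>
    have "C_order (m 0) r (W - K) (\<lambda>x. 0)" for r
      by (rule C_order_prod[where a = 0 and b = "\<lambda>i x. 0"]) (use WE Ck_const in auto)
    then have "(\<lambda>p x. 0) \<in> sects ?A (W - K) 0"
      by (simp add: model_sheaf_def C_infinity_def)
    then have "\<Phi> (W - K) 0 (0 *\<^sub>R (\<lambda>p x. 0)) = 0"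
      using lin_map_scale[OF lin[OF oK]] by (metis scaleR_zero_left)
    then show ?thesis by (simp add: zero_fun_def)
  qed
  finally have rK: "restr M U (P (W - K)) 0 r = 0" .
  \<comment> \<open>A set closed in \<open>U\<close> need not be closed in the manifold.
    \<open>P K\<close> is, being compact in a Hausdorff space, so \<open>V'\<close> is open and
    \<open>0\<close> can be glued to \<open>r\<close>.\<close>
  define V' where "V' = ?X - P K"
  have hP: "h ` P K = K" using surj KW by (auto simp: P_def)
  have PKU: "P K \<subseteq> U" by (auto simp: P_def)
  have "compactin (subtopology ?E W) (h ` P K)"
    using K KW hP by (simp add: compactin_subtopology)
  then have "compactin (subtopology (base M) U) (P K)"
    using homeomorphic_map_compactness[OF h, of "P K"] PKU unfolding topU by simp
  then have "compactin (base M) (P K)" by (simp add: compactin_subtopology)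
  then have V': "openin (base M) V'"
    unfolding V'_def using compactin_imp_closedin[OF Haus] by blast
  have UV': "U \<inter> V' = P (W - K)" using surj UX by (auto simp: V'_def P_def)
  let ?R = "\<lambda>Z u. Z = U \<and> u = r \<or> Z = V' \<and> u = 0"
  have "\<exists>g. g \<in> sects M ?X 0 \<and> (\<forall>Z u. ?R Z u \<longrightarrow> restr M ?X Z 0 g = u)"
  proof (rule glue[OF sh, where R = ?R and V = ?X and k = 0])
    show "openin (base M) Z \<and> u \<in> sects M Z 0" if "?R Z u" for Z u
      using that U V' r zero_in[OF sh] by auto
    have "openin (base M) (U \<inter> V')" using U V' by blast
    then have "restr M V' (U \<inter> V') 0 0 = 0" using restr_zero[OF sh V'] by simp
    moreover have "restr M U (U \<inter> V') 0 r = 0" using rK UV' by simp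
    ultimately show "restr M Z (Z \<inter> Z') 0 u = restr M Z' (Z \<inter> Z') 0 u'"
      if "?R Z u" "?R Z' u'" for Z u Z' u'
      using that by (auto simp: Int_commute)
    have "{Z. \<exists>u. ?R Z u} = {U, V'}" by auto
    moreover have "?X = U \<union> V'" using PKU UX by (auto simp: V'_def)
    ultimately show "?X = \<Union>{Z. \<exists>u. ?R Z u}" by simp
  qed blast
  then obtain g where g: "g \<in> sects M ?X 0" "restr M ?X U 0 g = r" "restr M ?X V' 0 g = 0" by blast
  have PT: "openin (base M) (P T)" by (rule Popen[OF T(1) TW])
  have PTU: "P T \<subseteq> U" by (auto simp: P_def)
  have PKV: "P K \<subseteq> V"
  proof
    fix z assume z: "z \<in> P K"
    then obtain z' where "z' \<in> U \<inter> V" "h z = h z'" using K(2) by (auto simp: P_def B_def)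
    then show "z \<in> V" using z inj by (auto simp: P_def inj_on_def)
  qed
  have "restr M ?X (P T) 0 g = gone M (P T)"
    using restr_restr[OF sh openin_topspace U PT PTU UX g(1)] g(2) rT by simp
  moreover have "x \<in> P T" using xU T by (simp add: P_def)
  moreover have "P T \<subseteq> V" using T PKV by (auto simp: P_def)
  moreover have "V \<union> V' = ?X" using PKV openin_subset[OF V] by (auto simp: V'_def)
  ultimately show "\<exists>\<rho> W V'. \<rho> \<in> sects M ?X 0 \<and> openin (base M) W \<and> x \<in> W \<and> W \<subseteq> V \<and>
      restr M ?X W 0 \<rho> = gone M W \<and> openin (base M) V' \<and> V \<union> V' = ?X \<and> restr M ?X V' 0 \<rho> = 0"
    using g PT V' by blast
qed

section \<open>Push-forward of modules and morphisms of bundles\<close>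

lemma continuous_map_preim:
  assumes "continuous_map X Y \<phi>"
  shows "openin Y V \<Longrightarrow> openin X (preim X \<phi> V)"
    and "preim X \<phi> (topspace Y) = topspace X"
    and "V \<subseteq> V' \<Longrightarrow> preim X \<phi> V \<subseteq> preim X \<phi> V'"
    and "preim X \<phi> (V \<inter> V') = preim X \<phi> V \<inter> preim X \<phi> V'"
    and "preim X \<phi> (\<Union>\<V>) = \<Union>(preim X \<phi> ` \<V>)"
  using assms unfolding preim_def continuous_map_def by auto

text \<open>Preimages commute with unions and intersections, which transfers the sheaf axioms; the
  module axioms use that \<open>\<phi>s\<close> is natural, unital and multiplicative.\<close>

lemma graded_module_sheaf_pushforward:
  assumes S: "graded_module_sheaf M S" and \<phi>: "continuous_map (base M) (base N) \<phi>"
    and \<phi>s: "galg_hom N (pushforward_alg (base N) \<phi> M) \<phi>s"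
  shows "graded_module_sheaf N (pushforward_mod (base N) \<phi> \<phi>s S)"
proof -
  let ?G = "pushforward_mod (base N) \<phi> \<phi>s S"
  define p where "p = preim (base M) \<phi>"
  note baseS = module_base[OF S] and sh = module_sheaf[OF S]
  have simps: "base ?G = base N" "sects ?G V = sects S (p V)" "restr ?G V W = restr S (p V) (p W)"
    "gact ?G V j k a = gact S (p V) j k (\<phi>s V j a)" for V W j k a
    by (simp_all add: pushforward_mod_def p_def baseS)
  note p = continuous_map_preim[OF \<phi>, folded p_def]
  have lin: "lin_map (sects N V k) (sects M (p V) k) (\<phi>s V k)" if "openin (base N) V" for V k
    using \<phi>s that by (simp add: galg_hom_def sheaf_hom_def pushforward_alg_def p_def)
  have nat: "\<phi>s W k (restr N V W k a) = restr M (p V) (p W) k (\<phi>s V k a)"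
    if "openin (base N) V" "openin (base N) W" "W \<subseteq> V" "a \<in> sects N V k" for V W k a
    using \<phi>s that by (simp add: galg_hom_def sheaf_hom_def pushforward_alg_def p_def)
  have one: "\<phi>s V 0 (gone N V) = gone M (p V)" if "openin (base N) V" for V
    using \<phi>s that by (simp add: galg_hom_def pushforward_alg_def p_def)
  have mult: "\<phi>s V (j + k) (gmul N V j k a b) = gmul M (p V) j k (\<phi>s V j a) (\<phi>s V k b)"
    if "openin (base N) V" "a \<in> sects N V j" "b \<in> sects N V k" for V j k a b
    using \<phi>s that by (simp add: galg_hom_def pushforward_alg_def p_def)
  have op: "openin (base S) (p V)" "openin (base M) (p V)" if "openin (base N) V" for V
    using p(1)[OF that] baseS by simp_all
  have "graded_sheaf ?G"
    unfolding graded_sheaf_def simps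
  proof (intro conjI allI impI ballI; (elim conjE)?)
    fix U k assume U: "openin (base N) U"
    show "subspace (sects S (p U) k)" by (rule sects_subspace[OF sh op(1)[OF U]])
    show "restr S (p U) (p U) k s = s" if "s \<in> sects S (p U) k" for s
      by (rule restr_id[OF sh op(1)[OF U] that])
  next
    fix U V k assume "openin (base N) U" "openin (base N) V" "V \<subseteq> U"
    then show "lin_map (sects S (p U) k) (sects S (p V) k) (restr S (p U) (p V) k)"
      by (intro restr_lin[OF sh] op p)
  next
    fix U V W k s
    assume "openin (base N) U" "openin (base N) V" "openin (base N) W" "W \<subseteq> V" "V \<subseteq> U"
      "s \<in> sects S (p U) k"
    then show "restr S (p V) (p W) k (restr S (p U) (p V) k s) = restr S (p U) (p W) k s"
      by (intro restr_restr[OF sh] op p)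
  next
    fix \<U> k s
    assume 1: "\<forall>U\<in>\<U>. openin (base N) U \<and> s U \<in> sects S (p U) k"
      and 2: "\<forall>U\<in>\<U>. \<forall>V\<in>\<U>. restr S (p U) (p (U \<inter> V)) k (s U) = restr S (p V) (p (U \<inter> V)) k (s V)"
    \<comment> \<open>Different members of \<open>\<U>\<close> may have the same preimage, so the
      family is not a function of \<open>p U\<close>; hence the relational form of gluing.\<close>
    let ?R = "\<lambda>Z u. \<exists>U\<in>\<U>. Z = p U \<and> u = s U"
    have sec: "openin (base S) (p U)" "s U \<in> sects S (p U) k" if "U \<in> \<U>" for U
      using 1 op(1) that by auto
    have un: "p (\<Union>\<U>) = \<Union>{Z. \<exists>u. ?R Z u}" using p(5) by auto
    have oun: "openin (base S) (p (\<Union>\<U>))" using 1 by (intro op(1)) blast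
    have "\<exists>t. t \<in> sects S (p (\<Union>\<U>)) k \<and> (\<forall>Z u. ?R Z u \<longrightarrow> restr S (p (\<Union>\<U>)) Z k t = u)"
    proof (rule glue[OF sh, where R = ?R and V = "p (\<Union>\<U>)" and k = k])
      show "openin (base S) Z \<and> u \<in> sects S Z k" if "?R Z u" for Z u using that sec by blast
      show "restr S Z (Z \<inter> Z') k u = restr S Z' (Z \<inter> Z') k u'"
        if "?R Z u" "?R Z' u'" for Z u Z' u'
        using that 2 p(4) by auto
    qed (use un in auto)
    then obtain t where t: "t \<in> sects S (p (\<Union>\<U>)) k"
      "\<And>U. U \<in> \<U> \<Longrightarrow> restr S (p (\<Union>\<U>)) (p U) k t = s U" by blast
    show "\<exists>!t. t \<in> sects S (p (\<Union>\<U>)) k \<and> (\<forall>U\<in>\<U>. restr S (p (\<Union>\<U>)) (p U) k t = s U)"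
    proof (rule ex1I[of _ t])
      fix t' assume t': "t' \<in> sects S (p (\<Union>\<U>)) k \<and> (\<forall>U\<in>\<U>. restr S (p (\<Union>\<U>)) (p U) k t' = s U)"
      show "t' = t"
      proof (rule separated[OF sh oun conjunct1[OF t'] t(1)])
        fix x assume "x \<in> p (\<Union>\<U>)"
        then obtain U where U: "U \<in> \<U>" "x \<in> p U" using p(5) by auto
        have "p U \<subseteq> p (\<Union>\<U>)" using U p(3) by blast
        moreover have "restr S (p (\<Union>\<U>)) (p U) k t' = restr S (p (\<Union>\<U>)) (p U) k t"
          using t(2)[OF U(1)] t' U(1) by simp
        ultimately show "\<exists>W. openin (base S) W \<and> x \<in> W \<and> W \<subseteq> p (\<Union>\<U>) \<and>
            restr S (p (\<Union>\<U>)) W k t' = restr S (p (\<Union>\<U>)) W k t"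
          using U(2) sec(1)[OF U(1)] by blast
      qed
    qed (use t in blast)
  qed
  then show ?thesis
    unfolding graded_module_sheaf_def simps
  proof (intro conjI allI impI ballI; (elim conjE)?)
    fix U j k a assume U: "openin (base N) U" and a: "a \<in> sects N U j"
    note a' = lin_map_in[OF lin[OF U] a]
    show "lin_map (sects S (p U) k) (sects S (p U) (j + k)) (gact S (p U) j k (\<phi>s U j a))"
      by (rule gact_lin[OF S op(2)[OF U] a'])
    fix V s assume V: "openin (base N) V" "V \<subseteq> U" and s: "s \<in> sects S (p U) k"
    show "restr S (p U) (p V) (j + k) (gact S (p U) j k (\<phi>s U j a) s) =
        gact S (p V) j k (\<phi>s V j (restr N U V j a)) (restr S (p U) (p V) k s)"
      using restr_gact[OF S op(2)[OF U] op(2)[OF V(1)] p(3)[OF V(2)] a' s] nat[OF U V a] by simp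
  next
    fix U j k s assume U: "openin (base N) U" and s: "s \<in> sects S (p U) k"
    show "lin_map (sects N U j) (sects S (p U) (j + k)) (\<lambda>a. gact S (p U) j k (\<phi>s U j a) s)"
      using gact_lin_left[OF S op(2)[OF U] s] lin[OF U] unfolding lin_map_def by simp
    show "gact S (p U) 0 k (\<phi>s U 0 (gone N U)) s = s"
      using gact_one[OF S op(2)[OF U] s] one[OF U] by simp
    fix i a b assume a: "a \<in> sects N U i" and b: "b \<in> sects N U j"
    show "gact S (p U) (i + j) k (\<phi>s U (i + j) (gmul N U i j a b)) s =
        gact S (p U) i (j + k) (\<phi>s U i a) (gact S (p U) j k (\<phi>s U j b) s)"
      using gact_assoc[OF S op(2)[OF U] lin_map_in[OF lin[OF U] a] lin_map_in[OF lin[OF U] b] s]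
        mult[OF U a b] by simp
  qed auto
qed

lemma graded_module_sheaf_dual:
  assumes "graded_manifold m M" "graded_vector_bundle M S"
  shows "graded_module_sheaf M (dual_sheaf M S)"
proof -
  have "graded_algebra_sheaf M" using assms(1) by (simp add: graded_manifold_def)
  then interpret module_pair M S "alg_mod M"
    using assms manifold_has_bumps graded_module_sheaf_alg_mod
    by unfold_locales (auto simp: graded_vector_bundle_def)
  show ?thesis unfolding dual_sheaf_eq by (rule graded_module_sheaf_hom)
qed

theorem proposition3p4:
  fixes m n :: "int \<Rightarrow> nat"
    and M :: "('a, 'f::real_vector) galg_sheaf" and S :: "('a, 'f, 's::real_vector) gmod_sheaf"
    and N :: "('b, 'g::real_vector) galg_sheaf" and P :: "('b, 'g, 'p::real_vector) gmod_sheaf"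
  assumes "graded_manifold m M" and "graded_manifold n N"
    and "graded_vector_bundle M S" and "graded_vector_bundle N P"
  shows "bij_betw (\<lambda>(\<phi>, \<Lambda>). (\<phi>, \<Lambda> (topspace (base N))))
           {(\<phi>, \<Lambda>). bundle_morphism m M S n N P (\<phi>, \<Lambda>)}
           {(\<phi>, \<Lambda>\<^sub>0). global_morphism_data m M S n N P (\<phi>, \<Lambda>\<^sub>0)}"
proof -
  let ?Y = "topspace (base N)" and ?P' = "dual_sheaf N P"
  define T where "T \<phi> = pushforward_mod (base N) (fst \<phi>) (snd \<phi>) (dual_sheaf M S)"
    for \<phi> :: "('a, 'f, 'b, 'g) gmap"
  \<comment> \<open>Bump functions on \<open>N\<close> are enough: they act on the dual of
    \<open>S\<close> through the pull-back, which is the action of the push-forward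
    \<open>T \<phi>\<close>.\<close>
  have pair: "module_pair N ?P' (T \<phi>)" if \<phi>: "graded_smooth_map m M n N \<phi>" for \<phi>
  proof
    show "graded_algebra_sheaf N" using assms(2) by (simp add: graded_manifold_def)
    show "has_bumps N" by (rule manifold_has_bumps[OF assms(2)])
    show "graded_module_sheaf N ?P'" by (rule graded_module_sheaf_dual[OF assms(2,4)])
    show "graded_module_sheaf N (T \<phi>)"
      unfolding T_def
      by (rule graded_module_sheaf_pushforward[OF graded_module_sheaf_dual[OF assms(1,3)]])
        (use \<phi> in \<open>auto simp: graded_smooth_map_def smooth_map_def\<close>)
  qed
  have morphism: "bundle_morphism m M S n N P (\<phi>, \<Lambda>) \<longleftrightarrow>
      graded_smooth_map m M n N \<phi> \<and> gmod_hom N ?P' (T \<phi>) \<Lambda>" for \<phi> \<Lambda>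
    by (simp add: bundle_morphism_def T_def)
  \<comment> \<open>In degree \<open>0\<close> the sign in \<open>hom_sects\<close> is
    \<open>1\<close>, and the preimage of \<open>?Y\<close> is the whole base of \<open>M\<close>;
    so linearity along the pull-back is linearity for the action on \<open>T \<phi>\<close>.\<close>
  have data: "global_morphism_data m M S n N P (\<phi>, \<Lambda>\<^sub>0) \<longleftrightarrow>
      graded_smooth_map m M n N \<phi> \<and> \<Lambda>\<^sub>0 \<in> hom_sects N ?P' (T \<phi>) ?Y 0" for \<phi> \<Lambda>\<^sub>0
  proof (cases "graded_smooth_map m M n N \<phi>")
    case True
    have "preim (base (dual_sheaf M S)) (fst \<phi>) ?Y = topspace (base M)"
      using True continuous_map_preim(2) module_base[OF graded_module_sheaf_dual[OF assms(1,3)]]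
      by (auto simp: graded_smooth_map_def smooth_map_def)
    then show ?thesis
      using True
      by (auto simp: global_morphism_data_def hom_sects_def T_def pushforward_mod_def Let_def)
  qed (simp add: global_morphism_data_def Let_def)
  \<comment> \<open>The map keeps \<open>\<phi>\<close>, so everything reduces to one fixed
    \<open>\<phi>\<close>, where morphisms correspond to their components over
    \<open>?Y\<close>.\<close>
  show ?thesis
  proof (rule bij_betwI')
    fix x y assume xy: "x \<in> {(\<phi>, \<Lambda>). bundle_morphism m M S n N P (\<phi>, \<Lambda>)}"
      "y \<in> {(\<phi>, \<Lambda>). bundle_morphism m M S n N P (\<phi>, \<Lambda>)}"
    obtain \<phi> \<Lambda> \<phi>' \<Lambda>' where eq: "x = (\<phi>, \<Lambda>)" "y = (\<phi>', \<Lambda>')" by (cases x, cases y)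
    have "\<Lambda> = \<Lambda>'" if "\<phi> = \<phi>'" "\<Lambda> ?Y = \<Lambda>' ?Y"
      using xy that module_pair.gmod_hom_unique[OF pair, of \<phi> \<Lambda> \<Lambda>'] by (auto simp: eq morphism)
    then show "((case x of (\<phi>, \<Lambda>) \<Rightarrow> (\<phi>, \<Lambda> ?Y)) = (case y of (\<phi>, \<Lambda>) \<Rightarrow> (\<phi>, \<Lambda> ?Y))) = (x = y)"
      by (auto simp: eq)
  next
    fix x assume "x \<in> {(\<phi>, \<Lambda>). bundle_morphism m M S n N P (\<phi>, \<Lambda>)}"
    then show "(case x of (\<phi>, \<Lambda>) \<Rightarrow> (\<phi>, \<Lambda> ?Y)) \<in>
        {(\<phi>, \<Lambda>\<^sub>0). global_morphism_data m M S n N P (\<phi>, \<Lambda>\<^sub>0)}"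
      using module_pair.gmod_hom_iff[OF pair] by (auto simp: morphism data)
  next
    fix y assume "y \<in> {(\<phi>, \<Lambda>\<^sub>0). global_morphism_data m M S n N P (\<phi>, \<Lambda>\<^sub>0)}"
    then obtain \<phi> L where y: "y = (\<phi>, L)" and \<phi>: "graded_smooth_map m M n N \<phi>"
      and L: "L \<in> hom_sects N ?P' (T \<phi>) ?Y 0" by (auto simp: data)
    obtain \<Lambda> where "gmod_hom N ?P' (T \<phi>) \<Lambda>" "\<Lambda> ?Y = L"
      by (rule module_pair.gmod_hom_exists[OF pair[OF \<phi>] L])
    then show "\<exists>x\<in>{(\<phi>, \<Lambda>). bundle_morphism m M S n N P (\<phi>, \<Lambda>)}. y = (case x of (\<phi>, \<Lambda>) \<Rightarrow> (\<phi>, \<Lambda> ?Y))"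
      using y \<phi> by (intro bexI[of _ "(\<phi>, \<Lambda>)"]) (auto simp: morphism)
  qed
qed

end
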